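(* Let $n \ge 1$, $l \ge 0$ be integers, $w, X_1,\ldots,X_n$ indeterminates, and for an integer $m\ge 0$ let $$R_m = \prod_{i=1}^n (X_i^{-1}+1+w+X_i)\cdot \frac{\det_{1 \le i, j \le n} \left( X_i^{j-1} (1+X_i)^{j-1} (1+ w X_i)^{n-j} - X_i^{m+2n-j} (1+X_i^{-1})^{j-1} (1+w X_i^{-1})^{n-j} \right)}{\prod_{i=1}^n (1-X_i) \prod_{1 \le i < j \le n} (1-X_i X_j)(X_j-X_i)}.$$ (1) Let $m=2l+1$ and $E_j=(n-j+l+1,\,j-l-2)$ for $j=1,\ldots,n$. Then $R_m = (-1)^{\binom{n+1}{2}} \prod_{i=1}^n X_i^{l}(X_i^{-1}+1+w+X_i)(1+X_i)\cdot \sum_{\mathcal{F}} \operatorname{sign}(\mathcal{F})\operatorname{wt}(\mathcal{F})$, where the sum is over all families $\mathcal{F}$ with endpoints $(E_j)$ whose initial segments are pairwise vertex-disjoint (the same holds with the sum over all families with endpoints $(E_j)$). If $w=1$, the same identity holds with the sum restricted to families of pairwise vertex-disjoint paths. If $w=0$, the identity holds with $E_j$ replaced by $E'_j=(n-j+l+1,\,2j-n-l-2)$ and the sum over families of pairwise vertex-disjoint paths. Moreover, for $w\in\{0,1\}$ (with endpoints $E'_j$ in the case $w=0$), $R_m = \prod_{i=1}^n X_i^{l}(X_i^{-1}+1+w+X_i)(1+X_i) \sum_{\mathcal{F}} (-1)^{\sum_{i: s_i=\alpha_i} i}\operatorname{wt}(\mathcal{F})$, the sum over families of pairwise vertex-disjoint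 paths. (2) Let $m=2l$ and let $E_j=\{(n-j+l+1,\,j-l-2),(n-j+l,\,j-l-1)\}$ be a set of two endpoints, $j=1,\ldots,n$. Then all statements of (1) hold with these endpoint sets, with the overall factor $(-1)^{\binom{n+1}{2}} \prod_{i=1}^n X_i^{l}(X_i^{-1}+1+w+X_i)$ (respectively $\prod_{i=1}^n X_i^{l}(X_i^{-1}+1+w+X_i)$ in the version with sign $(-1)^{\sum_{i:s_i=\alpha_i} i}$), and for $w=0$ with $E'_j=\{(n-j+l+1,\,2j-n-l-2),(n-j+l,\,2j-n-l-1)\}$.
   Context: For $i=1,\ldots,n$ let $\alpha_i=(-3i+1,-i+1)$, $\beta_i=(-i+1,-3i+1)$, $A_i=\{\alpha_i,\beta_i\}$. An admissible path from $s\in A_i$ to a lattice point $e$ is a lattice path consisting of an initial segment from $s$ to a point $P$ on the line $x+y=0$, all of whose points satisfy $x+y\le 0$, using only steps $(1,1),(-1,1)$ if $s=\alpha_i$ and only steps $(1,1),(1,-1)$ if $s=\beta_i$, followed by a segment from $P$ to $e$ using only steps $(1,0),(0,1)$ ($P$ is the last point of the path on $x+y=0$). The weight of such a path, when its endpoint is regarded as the endpoint of index $j$, is the product of: for each step of type $(-1,1)$ or $(1,-1)$ lying on the line $x+y=-2d$ ($d\ge 0$), the factor $X_{d/2+1}$ if $d$ is even and $X_{(d+1)/2}^{-1}$ if $d$ is odd; and for each step $(1,0)$ whose starting point satisfies $x+y\ge j-1$, the factor $w$; all other steps have weight $1$. Given endpoints (or endpoint sets) indexed by $j=1,\ldots,n$,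 a family $\mathcal{F}$ consists of a permutation $\sigma\in\mathcal{S}_n$, a choice $s_i\in A_i$ for each $i$, (in the case of endpoint sets, a choice of endpoint $e_i$ in the $\sigma(i)$-th set), and for each $i$ an admissible path from $s_i$ to the $\sigma(i)$-th endpoint, weighted with index $\sigma(i)$. Its weight $\operatorname{wt}(\mathcal{F})$ is the product of the path weights and $\operatorname{sign}(\mathcal{F})=\operatorname{sgn}\sigma\cdot(-1)^{\#\{i:\, s_i=\beta_i\}}$. *)

theory Defs
  imports
    "HOL-Library.FuncSet"
    "HOL-Library.Product_Plus"
    "HOL-Combinatorics.Permutations"
    "Jordan_Normal_Form.Determinant"
begin

type_synonym point = "int \<times> int"

definition height :: "point \<Rightarrow> int" where
  "height u = fst u + snd u"

definition alpha :: "nat \<Rightarrow> point" where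
  "alpha i = (- 3 * int i + 1, - int i + 1)"

definition beta :: "nat \<Rightarrow> point" where
  "beta i = (- int i + 1, - 3 * int i + 1)"

definition lattice_path :: "point set \<Rightarrow> point \<Rightarrow> point \<Rightarrow> point list \<Rightarrow> bool" where
  "lattice_path S a b p \<longleftrightarrow>
     p \<noteq> [] \<and> hd p = a \<and> last p = b \<and> successively (\<lambda>u v. v - u \<in> S) p"

text \<open>A path is represented by the vertex lists of its initial segment and of its final segment;
  the intermediate point P, the last point of the path on the line x + y = 0, is both the last
  vertex of the first list and the first vertex of the second one.\<close>

type_synonym path = "point list \<times> point list"

definition initial_steps :: "nat \<Rightarrow> point \<Rightarrow> point set" where
  "initial_steps i s = (if s = alpha i then {(1, 1), (-1, 1)} else {(1, 1), (1, -1)})"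

definition admissible_paths :: "nat \<Rightarrow> point \<Rightarrow> point \<Rightarrow> path set" where
  "admissible_paths i s e =
     {(p, q). \<exists>P. height P = 0 \<and>
        lattice_path (initial_steps i s) s P p \<and> (\<forall>u \<in> set p. height u \<le> 0) \<and>
        lattice_path {(1, 0), (0, 1)} P e q}"

definition initial_vertices :: "path \<Rightarrow> point set" where
  "initial_vertices \<pi> = set (fst \<pi>)"

definition vertices :: "path \<Rightarrow> point set" where
  "vertices \<pi> = set (fst \<pi>) \<union> set (snd \<pi>)"

definition level_weight :: "(nat \<Rightarrow> 'a::field) \<Rightarrow> nat \<Rightarrow> 'a" where
  "level_weight X d = (if even d then X (d div 2 + 1) else inverse (X ((d + 1) div 2)))"

definition step_weight :: "(nat \<Rightarrow> 'a::field) \<Rightarrow> 'a \<Rightarrow> nat \<Rightarrow> point \<Rightarrow> point \<Rightarrow> 'a" where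
  "step_weight X w j u v =
     (if v - u \<in> {(-1, 1), (1, -1)} then level_weight X (nat (- height u div 2))
      else if v - u = (1, 0) \<and> height u \<ge> int j - 1 then w
      else 1)"

definition segment_weight :: "(nat \<Rightarrow> 'a::field) \<Rightarrow> 'a \<Rightarrow> nat \<Rightarrow> point list \<Rightarrow> 'a" where
  "segment_weight X w j p = (\<Prod>(u, v)\<leftarrow>zip p (tl p). step_weight X w j u v)"

definition path_weight :: "(nat \<Rightarrow> 'a::field) \<Rightarrow> 'a \<Rightarrow> nat \<Rightarrow> path \<Rightarrow> 'a" where
  "path_weight X w j \<pi> = segment_weight X w j (fst \<pi>) * segment_weight X w j (snd \<pi>)"

record family =
  perm :: "nat \<Rightarrow> nat"
  start :: "nat \<Rightarrow> point"
  endpoint :: "nat \<Rightarrow> point"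
  paths :: "nat \<Rightarrow> path"

text \<open>The argument \<open>E\<close> gives the set of endpoints of each index. A single endpoint is treated as a
  singleton set. The components of a family are extensional functions on \<open>{1..n}\<close>, so
  distinct families differ on \<open>{1..n}\<close>.\<close>

definition families :: "nat \<Rightarrow> (nat \<Rightarrow> point set) \<Rightarrow> family set" where
  "families n E =
     {F. perm F permutes {1..n} \<and>
         start F \<in> (\<Pi>\<^sub>E i\<in>{1..n}. {alpha i, beta i}) \<and>
         endpoint F \<in> (\<Pi>\<^sub>E i\<in>{1..n}. E (perm F i)) \<and>
         paths F \<in> (\<Pi>\<^sub>E i\<in>{1..n}. admissible_paths i (start F i) (endpoint F i))}"

definition initially_disjoint_families :: "nat \<Rightarrow> (nat \<Rightarrow> point set) \<Rightarrow> family set" where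
  "initially_disjoint_families n E =
     {F \<in> families n E. \<forall>i\<in>{1..n}. \<forall>j\<in>{1..n}. i \<noteq> j \<longrightarrow>
        initial_vertices (paths F i) \<inter> initial_vertices (paths F j) = {}}"

definition disjoint_families :: "nat \<Rightarrow> (nat \<Rightarrow> point set) \<Rightarrow> family set" where
  "disjoint_families n E =
     {F \<in> families n E. \<forall>i\<in>{1..n}. \<forall>j\<in>{1..n}. i \<noteq> j \<longrightarrow>
        vertices (paths F i) \<inter> vertices (paths F j) = {}}"

definition family_weight :: "(nat \<Rightarrow> 'a::field) \<Rightarrow> 'a \<Rightarrow> nat \<Rightarrow> family \<Rightarrow> 'a" where
  "family_weight X w n F = (\<Prod>i=1..n. path_weight X w (perm F i) (paths F i))"

definition family_sign :: "nat \<Rightarrow> family \<Rightarrow> int" where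
  "family_sign n F = sign (perm F) * (-1) ^ card {i \<in> {1..n}. start F i = beta i}"

definition alpha_sign :: "nat \<Rightarrow> family \<Rightarrow> int" where
  "alpha_sign n F = (-1) ^ (\<Sum>i | i \<in> {1..n} \<and> start F i = alpha i. i)"

definition E_odd :: "nat \<Rightarrow> nat \<Rightarrow> nat \<Rightarrow> point set" where
  "E_odd n l j = {(int n - int j + int l + 1, int j - int l - 2)}"

definition E'_odd :: "nat \<Rightarrow> nat \<Rightarrow> nat \<Rightarrow> point set" where
  "E'_odd n l j = {(int n - int j + int l + 1, 2 * int j - int n - int l - 2)}"

definition E_even :: "nat \<Rightarrow> nat \<Rightarrow> nat \<Rightarrow> point set" where
  "E_even n l j =
     {(int n - int j + int l + 1, int j - int l - 2),
      (int n - int j + int l, int j - int l - 1)}"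

definition E'_even :: "nat \<Rightarrow> nat \<Rightarrow> nat \<Rightarrow> point set" where
  "E'_even n l j =
     {(int n - int j + int l + 1, 2 * int j - int n - int l - 2),
      (int n - int j + int l, 2 * int j - int n - int l - 1)}"

definition R_entry :: "(nat \<Rightarrow> 'a::field) \<Rightarrow> 'a \<Rightarrow> nat \<Rightarrow> nat \<Rightarrow> nat \<Rightarrow> nat \<Rightarrow> 'a" where
  "R_entry X w n m i j =
     X i ^ (j - 1) * (1 + X i) ^ (j - 1) * (1 + w * X i) ^ (n - j)
     - X i ^ (m + 2 * n - j) * (1 + inverse (X i)) ^ (j - 1) * (1 + w * inverse (X i)) ^ (n - j)"

text \<open>Matrices are indexed from 0, hence the shift of the indices.\<close>

definition R :: "(nat \<Rightarrow> 'a::field) \<Rightarrow> 'a \<Rightarrow> nat \<Rightarrow> nat \<Rightarrow> 'a" where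
  "R X w n m =
     (\<Prod>i=1..n. inverse (X i) + 1 + w + X i) *
     (det (mat n n (\<lambda>(i, j). R_entry X w n m (i + 1) (j + 1))) /
      ((\<Prod>i=1..n. 1 - X i) *
       (\<Prod>i=1..n. \<Prod>j=i+1..n. (1 - X i * X j) * (X j - X i))))"

text \<open>Indeterminates are rendered as elements of an arbitrary field at which the denominators of
  the rational functions involved do not vanish. The generators of a field of rational functions
  in \<open>w, X\<^sub>1, \<dots>, X\<^sub>n\<close>, or in \<open>X\<^sub>1, \<dots>, X\<^sub>n\<close> with \<open>w\<close> specialised to 0 or 1,
  are an instance.\<close>

definition generic :: "nat \<Rightarrow> (nat \<Rightarrow> 'a::field) \<Rightarrow> bool" where
  "generic n X \<longleftrightarrow>
     (\<forall>i\<in>{1..n}. X i \<noteq> 0 \<and> X i \<noteq> 1) \<and>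
     (\<forall>i\<in>{1..n}. \<forall>j\<in>{1..n}. i < j \<longrightarrow> X i * X j \<noteq> 1 \<and> X i \<noteq> X j)"

end

theory Submission
  imports Defs "HOL-Computational_Algebra.Formal_Laurent_Series"
begin

text \<open>Write \<open>v\<^sub>i = X\<^sub>i + 1/X\<^sub>i\<close> and \<open>u = z + 1/z\<close>. The initial segments from \<open>beta i\<close> to \<open>(x, -x)\<close>,
  and from \<open>alpha i\<close> to \<open>(-x, x)\<close>, are counted by the coefficient of \<open>z^x\<close> in the Laurent series
  \<open>F\<^sub>i = \<Prod>s\<le>i. 1 / (u - v\<^sub>s)\<close>; the final segments are counted by the coefficients of
  \<open>(1 + z)^(j-1) (1 + w z)^(n-j)\<close>. So the signed sum over all families is a determinant whose rows
  depend linearly on \<open>F\<^sub>1, \<dots>, F\<^sub>n\<close>. Newton interpolation expresses \<open>1 / (u - v\<^sub>r)\<close> triangularly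
  through the \<open>F\<^sub>i\<close> with diagonal entries \<open>\<Prod>s<r. v\<^sub>r - v\<^sub>s\<close>, and the coefficients of
  \<open>1 / (u - v\<^sub>r)\<close> turn the rows into those of the determinant in \<open>R\<close>.

  Exchanging the tails of two paths at a common vertex cancels the families with intersecting
  initial segments. It also cancels those with intersecting final segments whenever the final
  segments all have weight 1, that is for \<open>w = 1\<close>, or for the shortened endpoints when \<open>w = 0\<close>.
  For disjoint families planarity forces the order of the paths, so the starting points
  determine the inversions, hence the sign, of the permutation.\<close>

subsection \<open>Determinants over index sets\<close>

definition det_on :: "'b set \<Rightarrow> ('b \<Rightarrow> 'b \<Rightarrow> 'a::comm_ring_1) \<Rightarrow> 'a" where
  "det_on A f = (\<Sum>\<sigma> | \<sigma> permutes A. of_int (sign \<sigma>) * (\<Prod>i\<in>A. f i (\<sigma> i)))"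

lemma det_on_cong:
  assumes "\<And>i j. i \<in> A \<Longrightarrow> j \<in> A \<Longrightarrow> f i j = g i j"
  shows "det_on A f = det_on A g"
  unfolding det_on_def
  by (intro sum.cong refl arg_cong2[where f = "(*)"] prod.cong assms) (auto dest: permutes_in_image)

lemma det_on_scale_rows: "det_on A (\<lambda>i j. c i * f i j) = (\<Prod>i\<in>A. c i) * det_on A f"
  unfolding det_on_def by (simp add: prod.distrib sum_distrib_left mult_ac)

lemma det_on_reindex:
  assumes "finite A" and h: "bij_betw h A B"
  shows "det_on A (\<lambda>i j. f (h i) (h j)) = det_on B f"
  unfolding det_on_def
proof (rule sum.reindex_bij_witness[where i = "map_permutation B (inv_into A h)"
      and j = "map_permutation A h"])
  have h': "bij_betw (inv_into A h) B A" and inj: "inj_on h A" and B: "B = h ` A"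
    using h by (auto intro: bij_betw_inv_into dest: bij_betw_imp_inj_on bij_betw_imp_surj_on)
  show "map_permutation A h (map_permutation B (inv_into A h) p) = p"
    "map_permutation B (inv_into A h) p \<in> {p. p permutes A}" if "p \<in> {p. p permutes B}" for p
    using that map_permutation_compose_inv[OF h', of p h] map_permutation_permutes[OF h', of p]
    by (simp_all add: B f_inv_into_f)
  fix p assume "p \<in> {p. p permutes A}"
  then have p: "p permutes A" by simp
  show "map_permutation B (inv_into A h) (map_permutation A h p) = p"
    by (rule map_permutation_compose_inv[OF h p]) (simp add: inj)
  show "map_permutation A h p \<in> {p. p permutes B}"
    using map_permutation_permutes[OF h p] by simp
  have "(\<Prod>i\<in>B. f i (map_permutation A h p i)) = (\<Prod>i\<in>A. f (h i) (h (p i)))"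
    unfolding B prod.reindex[OF inj] using inj by (simp add: map_permutation_apply)
  then show "of_int (sign (map_permutation A h p)) * (\<Prod>i\<in>B. f i (map_permutation A h p i)) =
      of_int (sign p) * (\<Prod>i\<in>A. f (h i) (h (p i)))"
    using sign_map_permutation[OF inj p \<open>finite A\<close>] by simp
qed

lemma det_mat_eq_det_on:
  "det (mat n n (\<lambda>(i, j). f (i + 1) (j + 1))) = det_on {1..n} f"
proof -
  have "bij_betw Suc {0..<n} {1..n}"
    by (simp add: bij_betw_def atLeastLessThanSuc_atLeastAtMost)
  then have "det_on {0..<n} (\<lambda>i j. f (Suc i) (Suc j)) = det_on {1..n} f"
    by (intro det_on_reindex) auto
  then show ?thesis
    by (subst det_def'[of _ n])
      (auto simp: det_on_def permutes_in_image intro!: sum.cong prod.cong dest: permutes_in_image)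
qed

lemma det_lower_triangular_mat:
  "det (mat n n (\<lambda>(i, k). if k \<le> i then b (i + 1) (k + 1) else 0)) =
      (\<Prod>i=1..n. b i i :: 'a::comm_ring_1)"
proof -
  let ?B = "mat n n (\<lambda>(i, k). if k \<le> i then b (i + 1) (k + 1) else 0)"
  have "det ?B = prod_list (diag_mat ?B)"
    by (rule det_lower_triangular[of n]) auto
  also have "\<dots> = (\<Prod>i=0..<n. b (i + 1) (i + 1))"
    by (auto simp: prod_list_diag_prod intro!: prod.cong)
  also have "\<dots> = (\<Prod>i=1..n. b i i)"
    using prod.shift_bounds_Suc_ivl[of "\<lambda>i. b i i" 0 n]
    by (simp add: atLeastLessThanSuc_atLeastAtMost)
  finally show ?thesis .
qed

lemma det_on_lower_triangular_mult:
  fixes n :: nat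
  assumes "\<And>i j. i \<in> {1..n} \<Longrightarrow> j \<in> {1..n} \<Longrightarrow> f i j = (\<Sum>k=1..i. b i k * g k j)"
  shows "det_on {1..n} f = (\<Prod>i=1..n. b i i) * det_on {1..n} g"
proof -
  define B where "B = mat n n (\<lambda>(i, k). if k \<le> i then b (i + 1) (k + 1) else 0)"
  define M where "M = mat n n (\<lambda>(i, j). g (i + 1) (j + 1))"
  have "mat n n (\<lambda>(i, j). f (i + 1) (j + 1)) = B * M"
  proof (rule eq_matI)
    fix i j assume "i < dim_row (B * M)" "j < dim_col (B * M)"
    then have ij: "i < n" "j < n" by (auto simp: B_def M_def)
    have "(B * M) $$ (i, j) =
        (\<Sum>k=0..<n. if k \<le> i then b (i + 1) (k + 1) * g (k + 1) (j + 1) else 0)"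
      using ij by (auto simp: B_def M_def scalar_prod_def intro!: sum.cong)
    also have "\<dots> = (\<Sum>k=0..<Suc i. b (i + 1) (k + 1) * g (k + 1) (j + 1))"
      using ij by (intro sum.mono_neutral_cong_right) auto
    also have "\<dots> = (\<Sum>k=1..i + 1. b (i + 1) k * g k (j + 1))"
      using sum.shift_bounds_Suc_ivl[of "\<lambda>k. b (i + 1) k * g k (j + 1)" 0 "Suc i"]
      by (simp add: atLeastLessThanSuc_atLeastAtMost)
    also have "\<dots> = f (i + 1) (j + 1)"
      using ij by (simp add: assms)
    finally show "mat n n (\<lambda>(i, j). f (i + 1) (j + 1)) $$ (i, j) = (B * M) $$ (i, j)"
      using ij by simp
  qed (auto simp: B_def M_def)
  moreover have "det (B * M) = det B * det M"
    by (rule det_mult[of _ n]) (auto simp: B_def M_def)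
  ultimately show ?thesis
    unfolding det_mat_eq_det_on[symmetric] by (simp add: M_def B_def det_lower_triangular_mat)
qed

lemma det_on_sum:
  assumes "finite A" and "\<And>i j. i \<in> A \<Longrightarrow> j \<in> A \<Longrightarrow> finite (T i j)"
  shows "det_on A (\<lambda>i j. \<Sum>y\<in>T i j. f i j y) =
    (\<Sum>\<sigma> | \<sigma> permutes A. \<Sum>g\<in>(\<Pi>\<^sub>E i\<in>A. T i (\<sigma> i)). of_int (sign \<sigma>) * (\<Prod>i\<in>A. f i (\<sigma> i) (g i)))"
  unfolding det_on_def
proof (rule sum.cong[OF refl])
  fix \<sigma> assume "\<sigma> \<in> {\<sigma>. \<sigma> permutes A}"
  then have "finite (T i (\<sigma> i))" if "i \<in> A" for i
    using assms(2) that by (simp add: permutes_in_image)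
  with assms(1) show "of_int (sign \<sigma>) * (\<Prod>i\<in>A. \<Sum>y\<in>T i (\<sigma> i). f i (\<sigma> i) y) =
      (\<Sum>g\<in>(\<Pi>\<^sub>E i\<in>A. T i (\<sigma> i)). of_int (sign \<sigma>) * (\<Prod>i\<in>A. f i (\<sigma> i) (g i)))"
    by (subst prod_sum_PiE) (simp_all add: sum_distrib_left)
qed

subsection \<open>Signs and inversions\<close>

definition cycle_up :: "nat \<Rightarrow> nat \<Rightarrow> nat \<Rightarrow> nat" where
  "cycle_up m n k = (if k = m then n else if m < k \<and> k \<le> n then k - 1 else k)"

lemma cycle_up_self: "cycle_up m m = id"
  by (auto simp: cycle_up_def)

lemma cycle_up_Suc: "m \<le> n \<Longrightarrow> cycle_up m (Suc n) = transpose n (Suc n) \<circ> cycle_up m n"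
  by (intro ext) (auto simp: cycle_up_def transpose_def)

lemma cycle_up_less_iff: "j \<noteq> m \<Longrightarrow> k \<noteq> m \<Longrightarrow> cycle_up m n j < cycle_up m n k \<longleftrightarrow> j < k"
  by (auto simp: cycle_up_def)

lemma cycle_up_permutes:
  assumes "m \<le> n"
  shows "cycle_up m n permutes {m..n}"
  using assms
proof (induction n rule: dec_induct)
  case (step n)
  then have "cycle_up m n permutes {m..Suc n}"
    by (auto elim: permutes_subset)
  with step show ?case
    unfolding cycle_up_Suc[OF step(1)] by (intro permutes_compose permutes_swap_id) auto
qed (simp only: cycle_up_self permutes_id)

lemma sign_cycle_up: "m \<le> n \<Longrightarrow> sign (cycle_up m n) = (-1) ^ (n - m)"
proof (induction n rule: dec_induct)
  case (step n)
  have "permutation (cycle_up m n)"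
    using cycle_up_permutes[OF step(1)] by (rule permutes_imp_permutation[rotated]) simp
  with step show ?case
    unfolding cycle_up_Suc[OF step(1)]
    by (subst sign_compose) (simp_all add: permutation_swap_id sign_swap_id Suc_diff_le)
qed (simp add: cycle_up_self)

definition inversions :: "'a::linorder set \<Rightarrow> ('a \<Rightarrow> 'a) \<Rightarrow> ('a \<times> 'a) set" where
  "inversions A \<sigma> = {(i, j) \<in> A \<times> A. i < j \<and> \<sigma> j < \<sigma> i}"

lemma card_inversions_Suc:
  assumes \<sigma>: "\<sigma> permutes {1..Suc n}"
  shows "card (inversions {1..Suc n} \<sigma>) = card (inversions {1..n} \<sigma>) + (Suc n - \<sigma> (Suc n))"
proof -
  let ?I = "{i \<in> {1..n}. \<sigma> (Suc n) < \<sigma> i}"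
  have \<sigma>_le: "\<sigma> i \<le> Suc n" if "i \<in> {1..Suc n}" for i
    using permutes_in_image[OF \<sigma>, of i] that by simp
  have "\<sigma> ` ?I = {\<sigma> (Suc n)<..Suc n}"
  proof (rule subset_antisym; rule subsetI)
    fix k assume k: "k \<in> {\<sigma> (Suc n)<..Suc n}"
    then obtain i where i: "k = \<sigma> i" using permutes_surj[OF \<sigma>] by (metis surjD)
    then have "i \<in> {1..Suc n}" using k permutes_in_image[OF \<sigma>, of i] by auto
    with k show "k \<in> \<sigma> ` ?I" unfolding i by (auto simp: le_Suc_eq)
  qed (auto simp: \<sigma>_le)
  then have "card ?I = Suc n - \<sigma> (Suc n)"
    using card_image[OF inj_on_subset[OF permutes_inj[OF \<sigma>] subset_UNIV], of ?I] by simp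
  moreover have "inversions {1..Suc n} \<sigma> = inversions {1..n} \<sigma> \<union> (\<lambda>i. (i, Suc n)) ` ?I"
    by (auto simp: inversions_def le_Suc_eq)
  moreover have "card (inversions {1..n} \<sigma> \<union> (\<lambda>i. (i, Suc n)) ` ?I) =
      card (inversions {1..n} \<sigma>) + card ((\<lambda>i. (i, Suc n)) ` ?I)"
    by (rule card_Un_disjoint)
      (auto simp: inversions_def intro: finite_subset[of _ "{1..n} \<times> {1..n}"])
  ultimately show ?thesis
    by (simp add: card_image inj_on_def)
qed

lemma sign_eq_inversions:
  fixes n :: nat
  assumes "\<sigma> permutes {1..n}"
  shows "sign \<sigma> = (-1) ^ card (inversions {1..n} \<sigma>)"
  using assms
proof (induction n arbitrary: \<sigma>)
  case 0
  then show ?case by (simp add: inversions_def)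
next
  case (Suc n)
  define m where "m = \<sigma> (Suc n)"
  define \<tau> where "\<tau> = cycle_up m (Suc n) \<circ> \<sigma>"
  have m: "1 \<le> m" "m \<le> Suc n"
    using permutes_in_image[OF Suc.prems, of "Suc n"] by (auto simp: m_def)
  have cycle: "cycle_up m (Suc n) permutes {1..Suc n}"
    using cycle_up_permutes[OF m(2)] m(1) by (auto elim: permutes_subset)
  have "\<tau> permutes {1..Suc n}"
    unfolding \<tau>_def using Suc.prems cycle by (rule permutes_compose)
  then have \<tau>: "\<tau> permutes {1..n}"
    by (rule permutes_superset) (auto simp: \<tau>_def m_def cycle_up_def le_Suc_eq)
  have "\<sigma> i \<noteq> m" if "i \<in> {1..n}" for i
    using permutes_inj[OF Suc.prems] that by (auto simp: m_def dest!: injD)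
  then have "inversions {1..n} \<tau> = inversions {1..n} \<sigma>"
    by (auto simp: inversions_def \<tau>_def cycle_up_less_iff)
  then have "(-1) ^ card (inversions {1..n} \<sigma>) = sign \<tau>"
    by (simp add: Suc.IH[OF \<tau>])
  also have "\<dots> = (-1) ^ (Suc n - m) * sign \<sigma>"
    unfolding \<tau>_def using cycle Suc.prems sign_cycle_up[OF m(2)]
    by (subst sign_compose) (auto intro: permutes_imp_permutation)
  finally have "(-1) ^ (Suc n - m) * (-1) ^ card (inversions {1..n} \<sigma>) = sign \<sigma>"
    by (simp flip: mult.assoc power_mult_distrib)
  then show ?case
    unfolding card_inversions_Suc[OF Suc.prems] by (simp add: power_add m_def mult.commute)
qed

subsection \<open>Resolvents as Laurent series\<close>

lemma newton_interpolation_inverse: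
  fixes u x :: "'a::field" and r :: nat
  assumes "\<And>s. s \<in> {1..r} \<Longrightarrow> u \<noteq> v s" and "u \<noteq> x"
  shows "inverse (u - x) = (\<Sum>i=1..r. (\<Prod>s\<in>{1..<i}. x - v s) * (\<Prod>s=1..i. inverse (u - v s)))
    + (\<Prod>s=1..r. x - v s) * (\<Prod>s=1..r. inverse (u - v s)) * inverse (u - x)"
  using assms(1)
proof (induction r)
  case (Suc r)
  let ?P = "\<Prod>s=1..r. x - v s" and ?Q = "\<Prod>s=1..r. inverse (u - v s)" and ?a = "v (Suc r)"
  have "inverse (u - x) = inverse (u - ?a) + (x - ?a) * inverse (u - ?a) * inverse (u - x)"
    using inverse_diff_inverse[of "u - x" "u - ?a"] Suc.prems[of "Suc r"] assms(2)
    by (simp add: algebra_simps)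
  then have "?P * ?Q * inverse (u - x) =
      ?P * ?Q * (inverse (u - ?a) + (x - ?a) * inverse (u - ?a) * inverse (u - x))"
    by (rule arg_cong)
  also have "\<dots> = ?P * (\<Prod>s=1..Suc r. inverse (u - v s))
      + (\<Prod>s=1..Suc r. x - v s) * (\<Prod>s=1..Suc r. inverse (u - v s)) * inverse (u - x)"
    by (simp add: distrib_left mult_ac)
  finally show ?case
    using Suc by (simp add: atLeastLessThanSuc_atLeastAtMost add.assoc)
qed simp

lemma newton_interpolation_inverse_at_node:
  fixes u :: "'a::field" and r :: nat
  assumes "\<And>s. s \<in> {1..r} \<Longrightarrow> u \<noteq> v s" and "r \<ge> 1"
  shows "inverse (u - v r) = (\<Sum>i=1..r. (\<Prod>s\<in>{1..<i}. v r - v s) * (\<Prod>s=1..i. inverse (u - v s)))"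
proof -
  have "(\<Prod>s=1..r. v r - v s) = 0"
    using assms(2) by (intro prod_zero) auto
  then show ?thesis
    using newton_interpolation_inverse[of r u v "v r"] assms by (simp del: prod_zero_iff)
qed

lemma fls_const_prod: "fls_const (\<Prod>i\<in>A. f i) = (\<Prod>i\<in>A. fls_const (f i :: 'a::comm_semiring_1))"
  by (induction A rule: infinite_finite_induct) (simp_all flip: fls_const_mult_const)

definition resolvent :: "'a::field \<Rightarrow> 'a fls" where
  "resolvent v = inverse (fls_X + inverse fls_X - fls_const v)"

lemma fls_X_plus_inverse_neq_const: "fls_X + inverse fls_X \<noteq> (fls_const v :: 'a::field fls)"
proof
  assume "fls_X + inverse fls_X = fls_const v"
  then have "fls_nth (fls_X + inverse fls_X) 1 = fls_nth (fls_const v) 1" by simp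
  then show False by (simp add: fls_inverse_X)
qed

lemma resolvent_newton:
  fixes r :: nat
  assumes "r \<ge> 1"
  shows "resolvent (v r) =
      (\<Sum>i=1..r. fls_const (\<Prod>s\<in>{1..<i}. v r - v s) * (\<Prod>s=1..i. resolvent (v s)))"
  using newton_interpolation_inverse_at_node[where v = "\<lambda>s. fls_const (v s)",
      OF fls_X_plus_inverse_neq_const assms]
  by (simp add: resolvent_def fls_const_prod flip: fls_minus_const)

definition geometric_fps :: "'a::comm_ring_1 \<Rightarrow> 'a fps" where
  "geometric_fps c = Abs_fps (\<lambda>k. c ^ k)"

lemma geometric_fps_inverse: "(1 - fps_const c * fps_X) * geometric_fps c = 1"
  by (rule fps_ext) (simp add: geometric_fps_def left_diff_distrib mult.assoc power_eq_if)

lemma fls_geometric_inverse: "fps_to_fls (geometric_fps c) * (1 - fls_const c * fls_X) = 1"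
proof -
  have "fps_to_fls ((1 - fps_const c * fps_X) * geometric_fps c) = 1"
    by (simp only: geometric_fps_inverse fps_one_to_fls)
  then show ?thesis
    by (simp add: fls_times_fps_to_fls mult.commute)
qed

context
  fixes x :: "'a::field"
  assumes x: "x \<noteq> 0"
begin

abbreviation "resolvent_nth \<equiv> fls_nth (resolvent (x + inverse x))"

lemma resolvent_factor:
  "resolvent (x + inverse x) = fls_X * fps_to_fls (geometric_fps x) *
      fps_to_fls (geometric_fps (inverse x))"
proof -
  define a b z where "a = fls_const x" "b = fls_const (inverse x)" "z = (fls_X :: 'a fls)"
  define A B where "A = fps_to_fls (geometric_fps x)" "B = fps_to_fls (geometric_fps (inverse x))"
  define D where "D = z + inverse z - (a + b)"
  have "a * b = 1" "z \<noteq> 0"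
    using x by (simp_all add: a_b_z_def)
  then have "z * D = (1 - a * z) * (1 - b * z)"
    by (simp add: D_def algebra_simps)
  moreover have "D * (z * A * B) = z * D * (A * B)"
    by (simp only: mult_ac)
  ultimately have "D * (z * A * B) = (A * (1 - a * z)) * (B * (1 - b * z))"
    by (simp only: mult_ac)
  also have "\<dots> = 1"
    by (simp add: a_b_z_def A_B_def fls_geometric_inverse)
  finally have "inverse D = z * A * B"
    by (rule inverse_unique)
  then show ?thesis
    by (simp add: resolvent_def D_def a_b_z_def A_B_def flip: fls_plus_const)
qed

lemma resolvent_partial_fractions:
  "fls_const (x - inverse x) * resolvent (x + inverse x) =
    fps_to_fls (geometric_fps x) - fps_to_fls (geometric_fps (inverse x))"
  "fls_const (x - 1) * ((1 + fls_X) * resolvent (x + inverse x)) =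
    fps_to_fls (geometric_fps x) - fls_const x * fps_to_fls (geometric_fps (inverse x)) +
        fls_const (x - 1)"
proof -
  define a b z where "a = fls_const x" "b = fls_const (inverse x)" "z = (fls_X :: 'a fls)"
  define A B where "A = fps_to_fls (geometric_fps x)" "B = fps_to_fls (geometric_fps (inverse x))"
  have A: "A * (1 - a * z) = 1" and B: "B * (1 - b * z) = 1"
    by (simp_all add: a_b_z_def A_B_def fls_geometric_inverse)
  have "a * b = 1"
    using x by (simp add: a_b_z_def)
  then have ab: "a * (b * c) = c" for c
    by (simp flip: mult.assoc)
  have "(a - b) * (z * A * B) = A * (B * (1 - b * z)) - B * (A * (1 - a * z))"
    by (simp add: algebra_simps)
  then have "(a - b) * (z * A * B) = A - B"
    by (simp add: A B)
  moreover have "(a - 1) * ((1 + z) * (z * A * B)) =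
      A * (B * (1 - b * z)) - a * B * (A * (1 - a * z))
      + (a - 1) * ((A * (1 - a * z)) * (B * (1 - b * z)))"
    by (simp add: algebra_simps ab)
  then have "(a - 1) * ((1 + z) * (z * A * B)) = A - a * B + (a - 1)"
    by (simp add: A B)
  ultimately show "fls_const (x - inverse x) * resolvent (x + inverse x) =
      fps_to_fls (geometric_fps x) - fps_to_fls (geometric_fps (inverse x))"
    "fls_const (x - 1) * ((1 + fls_X) * resolvent (x + inverse x)) =
      fps_to_fls (geometric_fps x) - fls_const x * fps_to_fls (geometric_fps (inverse x)) +
          fls_const (x - 1)"
    by (simp_all add: resolvent_factor A_B_def a_b_z_def flip: fls_minus_const)
qed

lemma resolvent_nth:
  "(x - inverse x) * resolvent_nth k = (if k < 0 then 0 else x powi k - x powi (- k))"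
proof -
  have "(x - inverse x) * resolvent_nth k =
      fls_nth (fps_to_fls (geometric_fps x) - fps_to_fls (geometric_fps (inverse x))) k"
    by (simp flip: resolvent_partial_fractions(1))
  then show ?thesis
    by (auto simp: geometric_fps_def power_int_def)
qed

lemma resolvent_nth_pair:
  "(x - 1) * (resolvent_nth k + resolvent_nth (k - 1)) =
      (if k \<le> 0 then 0 else x powi k - x powi (1 - k))"
proof -
  have "(x - 1) * (resolvent_nth k + resolvent_nth (k - 1)) =
      fls_nth (fls_const (x - 1) * ((1 + fls_X) * resolvent (x + inverse x))) k"
    by (simp add: distrib_right fls_X_times_conv_shift)
  also have "\<dots> = (if k \<le> 0 then 0 else x powi k - x * inverse x powi k)"
    unfolding resolvent_partial_fractions(2) by (auto simp: geometric_fps_def power_int_def)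
  finally show ?thesis
    using x by (simp add: power_int_diff power_int_inverse divide_inverse)
qed

lemma resolvent_nth_antisym:
  "(x - inverse x) * (resolvent_nth (- k) - resolvent_nth k) = x powi (- k) - x powi k"
  unfolding right_diff_distrib resolvent_nth by auto

lemma resolvent_nth_pair_antisym:
  "(x - 1) *
    ((resolvent_nth (1 - k) + resolvent_nth (- k)) - (resolvent_nth k + resolvent_nth (k - 1))) =
    x powi (1 - k) - x powi k"
proof -
  have "(x - 1) * (resolvent_nth (1 - k) + resolvent_nth (- k)) =
      (if 1 - k \<le> 0 then 0 else x powi (1 - k) - x powi k)"
    using resolvent_nth_pair[of "1 - k"] by simp
  then show ?thesis
    unfolding right_diff_distrib[of "x - 1"] resolvent_nth_pair by auto
qed

end

subsection \<open>Antisymmetric coefficients\<close>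

text \<open>The coefficient of \<open>z^x\<close> in \<open>p(z) (f(1/z) - f(z))\<close>.\<close>

definition antisym_coeff :: "'a::field poly \<Rightarrow> 'a fls \<Rightarrow> int \<Rightarrow> 'a" where
  "antisym_coeff p f x = (\<Sum>t\<le>degree p. coeff p t * (fls_nth f (int t - x) - fls_nth f (x - int t)))"

lemma antisym_coeff_altdef:
  assumes "degree p \<le> H"
  shows "antisym_coeff p f x = (\<Sum>t\<le>H. coeff p t * (fls_nth f (int t - x) - fls_nth f (x - int t)))"
  unfolding antisym_coeff_def using assms
  by (intro sum.mono_neutral_left) (auto simp: coeff_eq_0)

lemma antisym_coeff_linear_combination:
  "antisym_coeff p (\<Sum>i\<in>A. fls_const (c i) * f i) x = (\<Sum>i\<in>A. c i * antisym_coeff p (f i) x)"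
proof -
  have "antisym_coeff p (\<Sum>i\<in>A. fls_const (c i) * f i) x = (\<Sum>t\<le>degree p. \<Sum>i\<in>A.
      c i * (coeff p t * (fls_nth (f i) (int t - x) - fls_nth (f i) (x - int t))))"
    unfolding antisym_coeff_def fls_nth_sum sum_subtractf[symmetric] sum_distrib_left
    by (simp add: algebra_simps)
  also have "\<dots> = (\<Sum>i\<in>A. c i * antisym_coeff p (f i) x)"
    unfolding antisym_coeff_def sum_distrib_left by (rule sum.swap)
  finally show ?thesis .
qed

lemma sum_coeff_powi:
  fixes x :: "'a::field"
  assumes "x \<noteq> 0"
  shows "(\<Sum>t\<le>degree p. coeff p t * x powi (a + int t)) = x powi a * poly p x"
    and "(\<Sum>t\<le>degree p. coeff p t * x powi (a - int t)) = x powi a * poly p (inverse x)"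
  using assms
  by (auto simp: poly_altdef sum_distrib_left power_int_add power_int_diff power_inverse
      divide_inverse mult_ac intro!: sum.cong)

lemma antisym_coeff_resolvent:
  fixes x :: "'a::field"
  assumes "x \<noteq> 0"
  shows "(x - inverse x) * antisym_coeff p (resolvent (x + inverse x)) T =
      x powi (- T) * poly p x - x powi T * poly p (inverse x)"
proof -
  have "(x - inverse x) * antisym_coeff p (resolvent (x + inverse x)) T =
      (\<Sum>t\<le>degree p. coeff p t * (x powi (- T + int t) - x powi (T - int t)))"
    unfolding antisym_coeff_def sum_distrib_left
    using resolvent_nth_antisym[OF assms, of "T - int t" for t]
    by (intro sum.cong refl) (simp add: mult.left_commute)
  also have "\<dots> = x powi (- T) * poly p x - x powi T * poly p (inverse x)"
    unfolding right_diff_distrib sum_subtractf sum_coeff_powi[OF assms] ..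
  finally show ?thesis .
qed

lemma antisym_coeff_resolvent_pair:
  fixes x :: "'a::field"
  assumes "x \<noteq> 0"
  defines "r \<equiv> resolvent (x + inverse x)"
  shows "(x - 1) * (antisym_coeff p r T + antisym_coeff p r (T - 1)) =
      x powi (1 - T) * poly p x - x powi T * poly p (inverse x)"
proof -
  have "(x - 1) * (antisym_coeff p r T + antisym_coeff p r (T - 1)) =
      (\<Sum>t\<le>degree p. coeff p t * (x powi (1 - T + int t) - x powi (T - int t)))"
    unfolding antisym_coeff_def sum.distrib[symmetric] sum_distrib_left
  proof (rule sum.cong[OF refl])
    fix t
    define k where "k = T - int t"
    have k: "int t - T = - k" "int t - (T - 1) = 1 - k" "T - 1 - int t = k - 1"
        "1 - T + int t = 1 - k"
      by (simp_all add: k_def)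
    have "coeff p t *
        ((x - 1) * ((fls_nth r (1 - k) + fls_nth r (- k)) - (fls_nth r k + fls_nth r (k - 1)))) =
        coeff p t * (x powi (1 - k) - x powi k)"
      unfolding r_def resolvent_nth_pair_antisym[OF assms(1)] ..
    then show "(x - 1) * (coeff p t * (fls_nth r (int t - T) - fls_nth r (T - int t)) +
        coeff p t * (fls_nth r (int t - (T - 1)) - fls_nth r (T - 1 - int t))) =
      coeff p t * (x powi (1 - T + int t) - x powi (T - int t))"
      unfolding k k_def[symmetric] by (simp add: algebra_simps)
  qed
  also have "\<dots> = x powi (1 - T) * poly p x - x powi T * poly p (inverse x)"
    unfolding right_diff_distrib sum_subtractf sum_coeff_powi[OF assms(1)] ..
  finally show ?thesis .
qed

subsection \<open>Lattice paths\<close>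

lemma lattice_path_Nil [simp]: "\<not> lattice_path S a b []"
  by (simp add: lattice_path_def)

lemma lattice_path_Cons:
  "lattice_path S a b (u # p) \<longleftrightarrow>
     u = a \<and> (if p = [] then a = b else \<exists>s\<in>S. lattice_path S (a + s) b p)"
proof (cases p)
  case (Cons v q)
  then show ?thesis
    by (auto simp: lattice_path_def algebra_simps intro!: bexI[of _ "v - a"])
qed (auto simp: lattice_path_def)

lemma lattice_path_append:
  "lattice_path S a b (p @ v # q) \<longleftrightarrow> lattice_path S a v (p @ [v]) \<and> lattice_path S v b (v # q)"
proof (induction p arbitrary: a)
  case Nil
  then show ?case by (auto simp: lattice_path_def)
next
  case (Cons u p)
  then show ?case by (auto simp: lattice_path_Cons)
qed

lemma lattice_path_ends:
  assumes "lattice_path S a b p"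
  shows "hd p = a" "last p = b" "a \<in> set p" "b \<in> set p"
  using assms by (auto simp: lattice_path_def)

lemma lattice_path_sorted_wrt:
  assumes "lattice_path S a b p" and "\<And>u s. s \<in> S \<Longrightarrow> rel u (u + s)" and "transp rel"
  shows "sorted_wrt rel p"
proof -
  have "rel u v" if "v - u \<in> S" for u v
    using assms(2)[OF that, of u] by simp
  then have "successively rel p"
    using assms(1) unfolding lattice_path_def by (blast intro: successively_mono)
  with assms(3) show ?thesis
    by (simp add: successively_conv_sorted_wrt)
qed

lemma lattice_path_mono:
  fixes f :: "point \<Rightarrow> 'b::order"
  assumes "lattice_path S a b p" and "\<And>u s. s \<in> S \<Longrightarrow> f u \<le> f (u + s)" and "u \<in> set p"
  shows "f a \<le> f u" "f u \<le> f b"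
proof -
  obtain c d where p: "p = c @ u # d" using split_list[OF assms(3)] by blast
  have "sorted_wrt (\<lambda>u v. f u \<le> f v) p"
    by (rule lattice_path_sorted_wrt[where rel = "\<lambda>u v. f u \<le> f v", OF assms(1,2)])
      (auto intro: transpI)
  moreover have "a = hd p" "b = last p"
    using assms(1) by (simp_all add: lattice_path_def)
  ultimately show "f a \<le> f u" "f u \<le> f b"
    by (cases c; auto simp: p sorted_wrt_append)+
qed

lemma lattice_path_distinct:
  fixes f :: "point \<Rightarrow> 'b::order"
  assumes "lattice_path S a b p" and "\<And>u s. s \<in> S \<Longrightarrow> f u < f (u + s)"
  shows "distinct p"
proof -
  have "sorted_wrt (\<lambda>u v. f u < f v) p"
    by (rule lattice_path_sorted_wrt[where rel = "\<lambda>u v. f u < f v", OF assms]) (auto intro: transpI)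
  then show ?thesis
    by (induction p) auto
qed

lemma segment_weight_singleton [simp]: "segment_weight X w j [a] = 1"
  by (simp add: segment_weight_def)

lemma segment_weight_Cons:
  "p \<noteq> [] \<Longrightarrow> segment_weight X w j (a # p) = step_weight X w j a (hd p) * segment_weight X w j p"
  by (cases p) (auto simp: segment_weight_def)

lemma segment_weight_append:
  "segment_weight X w j (p @ v # q) = segment_weight X w j (p @ [v]) * segment_weight X w j (v # q)"
proof (induction p)
  case (Cons u p)
  then show ?case
    by (cases p) (auto simp: segment_weight_Cons mult_ac)
qed simp

lemma lattice_path_consecutive:
  assumes "lattice_path S a b p" and "(u, v) \<in> set (zip p (tl p))"
  shows "u \<in> set p" "v \<in> set p" "v - u \<in> S"
proof -
  obtain k where k: "Suc k < length p" "u = p ! k" "v = p ! Suc k"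
    using assms(2) by (auto simp: in_set_zip nth_tl less_diff_conv)
  then show "u \<in> set p" "v \<in> set p" "v - u \<in> S"
    using assms(1) by (auto simp: lattice_path_def successively_conv_nth)
qed

lemma segment_weight_cong:
  assumes "lattice_path S a b p"
    and "\<And>u v. u \<in> set p \<Longrightarrow> v \<in> set p \<Longrightarrow> v - u \<in> S \<Longrightarrow> step_weight X w j u v = step_weight X w j' u v"
  shows "segment_weight X w j p = segment_weight X w j' p"
  unfolding segment_weight_def using assms lattice_path_consecutive[OF assms(1)]
  by (intro arg_cong[where f = prod_list] map_cong) auto

lemma segment_weight_eq_1:
  assumes "lattice_path S a b p"
    and "\<And>u v. u \<in> set p \<Longrightarrow> v \<in> set p \<Longrightarrow> v - u \<in> S \<Longrightarrow> step_weight X w j u v = 1"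
  shows "segment_weight X w j p = 1"
proof -
  have "map (\<lambda>(u, v). step_weight X w j u v) (zip p (tl p)) = map (\<lambda>_. 1) (zip p (tl p))"
    using assms lattice_path_consecutive[OF assms(1)] by (intro map_cong) auto
  then show ?thesis
    by (simp add: segment_weight_def map_replicate_const)
qed

definition paths_within :: "point set \<Rightarrow> point set \<Rightarrow> point \<Rightarrow> point \<Rightarrow> point list set" where
  "paths_within S B a b = {p. lattice_path S a b p \<and> set p \<subseteq> B}"

lemma Nil_notin_paths_within [simp]: "[] \<notin> paths_within S B a b"
  by (simp add: paths_within_def)

lemma hd_paths_within: "p \<in> paths_within S B a b \<Longrightarrow> hd p = a"
  by (auto simp: paths_within_def lattice_path_ends)

lemma paths_within_outside: "a \<notin> B \<Longrightarrow> paths_within S B a b = {}"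
  using lattice_path_ends(3) by (fastforce simp: paths_within_def)

lemma paths_within_mono:
  fixes f :: "point \<Rightarrow> 'b::order"
  assumes "p \<in> paths_within S B a b" and "\<And>u s. s \<in> S \<Longrightarrow> f u \<le> f (u + s)"
  shows "f a \<le> f b"
proof -
  have "lattice_path S a b p" using assms(1) by (simp add: paths_within_def)
  from lattice_path_mono(1)[OF this assms(2) lattice_path_ends(4)[OF this]] show ?thesis .
qed

lemma paths_within_rec:
  assumes "a \<in> B"
  shows "paths_within S B a b =
    (if a = b then {[a]} else {}) \<union> (\<Union>s\<in>S. (#) a ` paths_within S B (a + s) b)" (is "_ = ?R")
proof (rule Set.set_eqI)
  show "p \<in> paths_within S B a b \<longleftrightarrow> p \<in> ?R" for p
    using assms
    by (cases p) (auto simp: paths_within_def lattice_path_Cons split: if_splits)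
qed

lemma finite_paths_within:
  assumes "a \<in> B" and "finite S" and "\<And>s. s \<in> S \<Longrightarrow> finite (paths_within S B (a + s) b)"
  shows "finite (paths_within S B a b)"
  unfolding paths_within_rec[OF assms(1)] using assms by auto

lemma sum_paths_within:
  assumes "a \<in> B" and "finite S" and fin: "\<And>s. s \<in> S \<Longrightarrow> finite (paths_within S B (a + s) b)"
  shows "(\<Sum>p\<in>paths_within S B a b. segment_weight X w j p) = of_bool (a = b) +
      (\<Sum>s\<in>S. step_weight X w j a (a + s) * (\<Sum>p\<in>paths_within S B (a + s) b. segment_weight X w j p))"
proof -
  let ?C = "\<lambda>s. (#) a ` paths_within S B (a + s) b"
  have "(\<Sum>p\<in>paths_within S B a b. segment_weight X w j p) =
      (\<Sum>p\<in>(if a = b then {[a]} else {}). segment_weight X w j p) +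
          (\<Sum>p\<in>(\<Union>s\<in>S. ?C s). segment_weight X w j p)"
    unfolding paths_within_rec[OF assms(1)] using assms
    by (intro sum.union_disjoint) (auto split: if_splits)
  also have "(\<Sum>p\<in>(if a = b then {[a]} else {}). segment_weight X w j p) = of_bool (a = b)"
    by simp
  also have "(\<Sum>p\<in>(\<Union>s\<in>S. ?C s). segment_weight X w j p) = (\<Sum>s\<in>S. \<Sum>p\<in>?C s. segment_weight X w j p)"
  proof (rule sum.UNION_disjoint)
    show "\<forall>s\<in>S. \<forall>t\<in>S. s \<noteq> t \<longrightarrow> ?C s \<inter> ?C t = {}"
      by (auto dest!: hd_paths_within)
  qed (use assms in auto)
  also have "\<dots> = (\<Sum>s\<in>S. step_weight X w j a (a + s) *
      (\<Sum>p\<in>paths_within S B (a + s) b. segment_weight X w j p))"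
  proof (rule sum.cong[OF refl])
    fix s
    have "segment_weight X w j (a # p) = step_weight X w j a (a + s) * segment_weight X w j p"
      if "p \<in> paths_within S B (a + s) b" for p
    proof -
      have "p \<noteq> []" using that by auto
      then show ?thesis using hd_paths_within[OF that] by (simp add: segment_weight_Cons)
    qed
    then show "(\<Sum>p\<in>?C s. segment_weight X w j p) =
        step_weight X w j a (a + s) * (\<Sum>p\<in>paths_within S B (a + s) b. segment_weight X w j p)"
      by (simp add: sum.reindex sum_distrib_left)
  qed
  finally show ?thesis .
qed

lemma sum_paths_within_two_steps:
  assumes "a \<in> B" "s \<noteq> t"
    and "finite (paths_within {s, t} B (a + s) b) \<and>
      (\<Sum>p\<in>paths_within {s, t} B (a + s) b. segment_weight X w j p) = W"
    and "finite (paths_within {s, t} B (a + t) b) \<and>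
      (\<Sum>p\<in>paths_within {s, t} B (a + t) b. segment_weight X w j p) = W'"
  shows "finite (paths_within {s, t} B a b) \<and>
    (\<Sum>p\<in>paths_within {s, t} B a b. segment_weight X w j p) =
      of_bool (a = b) + step_weight X w j a (a + s) * W + step_weight X w j a (a + t) * W'"
proof -
  have fin: "finite (paths_within {s, t} B (a + r) b)" if "r \<in> {s, t}" for r
    using assms(3,4) that by auto
  show ?thesis
    using finite_paths_within[OF assms(1) _ fin] sum_paths_within[OF assms(1) _ fin, of X w j]
      assms(2-4)
    by (simp add: add.assoc)
qed

subsection \<open>Initial segments\<close>

text \<open>The parameter \<open>\<epsilon> = -1\<close> gives the paths from \<open>alpha\<close>, and \<open>\<epsilon> = 1\<close> those from \<open>beta\<close>.\<close>

definition initial_paths :: "int \<Rightarrow> point \<Rightarrow> point \<Rightarrow> point list set" where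
  "initial_paths \<epsilon> = paths_within {(1, 1), (\<epsilon>, - \<epsilon>)} {u. height u \<le> 0}"

definition level_fps :: "(nat \<Rightarrow> 'a::field) \<Rightarrow> nat \<Rightarrow> 'a fps" where
  "level_fps X d = (\<Prod>e<d. geometric_fps (level_weight X e))"

lemma level_fps_0: "level_fps X 0 = 1"
  by (simp add: level_fps_def)

lemma level_fps_Suc_nth:
  "fps_nth (level_fps X (Suc d)) k = fps_nth (level_fps X d) k +
    (if k = 0 then 0 else level_weight X d * fps_nth (level_fps X (Suc d)) (k - 1))"
proof -
  define f c where "f = level_fps X (Suc d)" "c = level_weight X d"
  have "(1 - fps_const c * fps_X) * f =
      level_fps X d * ((1 - fps_const c * fps_X) * geometric_fps c)"
    by (simp add: level_fps_def f_c_def mult_ac)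
  then have "f - fps_const c * (fps_X * f) = level_fps X d"
    unfolding geometric_fps_inverse by (simp add: left_diff_distrib mult.assoc)
  then have "fps_nth f k = fps_nth (level_fps X d + fps_const c * (fps_X * f)) k"
    by (metis diff_add_cancel)
  then show ?thesis
    by (simp add: f_c_def)
qed

lemma initial_paths_mono:
  assumes "\<epsilon> \<in> {1, -1}" "p \<in> initial_paths \<epsilon> a b"
  shows "\<epsilon> * (fst a - snd a) \<le> \<epsilon> * (fst b - snd b)"
  by (rule paths_within_mono[where f = "\<lambda>u. \<epsilon> * (fst u - snd u)",
    OF assms(2)[unfolded initial_paths_def]])
    (use assms(1) in auto)

lemma sum_initial_paths_step:
  assumes "\<epsilon> \<in> {1, -1}" "height a = - 2 * int d"
    and "finite (initial_paths \<epsilon> (a + (1, 1)) b) \<and>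
      (\<Sum>p\<in>initial_paths \<epsilon> (a + (1, 1)) b. segment_weight X w j p) = W"
    and "finite (initial_paths \<epsilon> (a + (\<epsilon>, - \<epsilon>)) b) \<and>
      (\<Sum>p\<in>initial_paths \<epsilon> (a + (\<epsilon>, - \<epsilon>)) b. segment_weight X w j p) = W'"
  shows "finite (initial_paths \<epsilon> a b) \<and>
    (\<Sum>p\<in>initial_paths \<epsilon> a b. segment_weight X w j p) = of_bool (a = b) + W + level_weight X d * W'"
proof -
  have "step_weight X w j a (a + (1, 1)) = 1"
    "step_weight X w j a (a + (\<epsilon>, - \<epsilon>)) = level_weight X d"
    using assms(1,2) by (auto simp: step_weight_def)
  moreover have "a \<in> {u. height u \<le> 0}" "(1, 1) \<noteq> (\<epsilon>, - \<epsilon>)"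
    using assms(1,2) by auto
  ultimately show ?thesis
    using sum_paths_within_two_steps[of a "{u. height u \<le> 0}" "(1, 1)" "(\<epsilon>, - \<epsilon>)" b X w j W W']
      assms(3,4)
    by (simp add: initial_paths_def)
qed

lemma sum_initial_paths:
  assumes eps: "\<epsilon> \<in> {1, -1}"
    and "height a = - 2 * int d" "b = a + (int d + \<epsilon> * int k, int d - \<epsilon> * int k)"
  shows "finite (initial_paths \<epsilon> a b) \<and>
    (\<Sum>p\<in>initial_paths \<epsilon> a b. segment_weight X w j p) = fps_nth (level_fps X (Suc d)) k"
  using assms(2-)
proof (induction "d + k" arbitrary: a d k rule: less_induct)
  case less
  let ?W = "\<lambda>a. \<Sum>p\<in>initial_paths \<epsilon> a b. segment_weight X w j p"
  have up: "finite (initial_paths \<epsilon> (a + (1, 1)) b) \<and>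
      ?W (a + (1, 1)) = (if d = 0 then 0 else fps_nth (level_fps X d) k)"
  proof (cases d)
    case 0
    with less.prems have "a + (1, 1) \<notin> {u. height u \<le> 0}"
      by (simp add: height_def)
    with 0 show ?thesis
      by (simp add: initial_paths_def paths_within_outside)
  next
    case (Suc e)
    then show ?thesis
      using less.hyps[of e k "a + (1, 1)"] less.prems by (simp add: height_def algebra_simps)
  qed
  have flat: "finite (initial_paths \<epsilon> (a + (\<epsilon>, - \<epsilon>)) b) \<and>
      ?W (a + (\<epsilon>, - \<epsilon>)) = (if k = 0 then 0 else fps_nth (level_fps X (Suc d)) (k - 1))"
  proof (cases k)
    case 0
    then have "initial_paths \<epsilon> (a + (\<epsilon>, - \<epsilon>)) b = {}"
      using initial_paths_mono[OF eps, of _ "a + (\<epsilon>, - \<epsilon>)" b] eps less.prems by auto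
    with 0 show ?thesis by simp
  next
    case (Suc m)
    then show ?thesis
      using less.hyps[of d m "a + (\<epsilon>, - \<epsilon>)"] less.prems by (simp add: height_def algebra_simps)
  qed
  have "a = b \<longleftrightarrow> d = 0 \<and> k = 0"
    using eps less.prems(2) by (auto simp: prod_eq_iff)
  then show ?case
    using sum_initial_paths_step[OF eps less.prems(1) up flat]
    unfolding level_fps_Suc_nth[of X d k] by (auto simp: level_fps_0)
qed

definition side :: "nat \<Rightarrow> point \<Rightarrow> int" where
  "side i s = (if s = beta i then 1 else -1)"

lemma side_cases: "side i s \<in> {1, -1}"
  by (simp add: side_def)

lemma alpha_neq_beta: "i \<ge> 1 \<Longrightarrow> alpha i \<noteq> beta i"
  by (auto simp: alpha_def beta_def)

lemma start_coordinates:
  "s \<in> {alpha i, beta i} \<Longrightarrow> s = (1 - 2 * int i + side i s * int i, 1 - 2 * int i - side i s * int i)"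
  by (auto simp: side_def alpha_def beta_def)

lemma initial_steps_side:
  "i \<ge> 1 \<Longrightarrow> s \<in> {alpha i, beta i} \<Longrightarrow> initial_steps i s = {(1, 1), (side i s, - side i s)}"
  using alpha_neq_beta[of i] by (auto simp: initial_steps_def side_def)

definition node :: "(nat \<Rightarrow> 'a::field) \<Rightarrow> nat \<Rightarrow> 'a" where
  "node X i = X i + inverse (X i)"

definition start_series :: "(nat \<Rightarrow> 'a::field) \<Rightarrow> nat \<Rightarrow> 'a fls" where
  "start_series X i = (\<Prod>s=1..i. resolvent (node X s))"

lemma start_series_eq_level_fps:
  assumes "\<And>s. s \<in> {1..i} \<Longrightarrow> X s \<noteq> 0"
  shows "start_series X i = fls_X ^ i * fps_to_fls (level_fps X (2 * i))"
  using assms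
proof (induction i)
  case 0
  then show ?case by (simp add: start_series_def level_fps_def)
next
  case (Suc i)
  let ?G = "\<lambda>c. fps_to_fls (geometric_fps c)"
  have X: "X (Suc i) \<noteq> 0" and IH: "start_series X i = fls_X ^ i * fps_to_fls (level_fps X (2 * i))"
    using Suc by auto
  have level: "fps_to_fls (level_fps X (2 * Suc i)) =
      fps_to_fls (level_fps X (2 * i)) * (?G (X (Suc i)) * ?G (inverse (X (Suc i))))"
    by (simp add: level_fps_def level_weight_def fls_times_fps_to_fls mult.assoc)
  have "start_series X (Suc i) = start_series X i * resolvent (node X (Suc i))"
    by (simp add: start_series_def)
  also have "\<dots> = fls_X ^ Suc i * fps_to_fls (level_fps X (2 * Suc i))"
    unfolding IH node_def resolvent_factor[OF X] level power_Suc by (simp only: mult_ac)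
  finally show ?case .
qed

lemma sum_initial_paths_from_start:
  assumes i: "i \<ge> 1" and s: "s \<in> {alpha i, beta i}" and X: "\<And>t. t \<in> {1..i} \<Longrightarrow> X t \<noteq> 0"
  shows "finite (initial_paths (side i s) s (x, - x)) \<and>
    (\<Sum>p\<in>initial_paths (side i s) s (x, - x). segment_weight X w j p) =
      fls_nth (start_series X i) (side i s * x)"
proof -
  define \<epsilon> where "\<epsilon> = side i s"
  have eps: "\<epsilon> \<in> {1, -1}"
    unfolding \<epsilon>_def by (rule side_cases)
  have s_eq: "s = (1 - 2 * int i + \<epsilon> * int i, 1 - 2 * int i - \<epsilon> * int i)"
    unfolding \<epsilon>_def by (rule start_coordinates[OF s])
  have series: "fls_nth (start_series X i) (\<epsilon> * x) =
      fls_nth (fps_to_fls (level_fps X (2 * i))) (\<epsilon> * x - int i)"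
    by (subst start_series_eq_level_fps) (simp_all add: X fls_X_power_times_conv_shift)
  show ?thesis
  proof (cases "\<epsilon> * x < int i")
    case True
    have "initial_paths \<epsilon> s (x, - x) = {}"
      using initial_paths_mono[OF eps, of _ s "(x, - x)"] True eps by (auto simp: s_eq)
    with True show ?thesis
      unfolding \<epsilon>_def[symmetric] series by simp
  next
    case False
    define d k where "d = 2 * i - 1" "k = nat (\<epsilon> * x - int i)"
    have d: "int d = 2 * int i - 1" "Suc d = 2 * i" and k: "int k = \<epsilon> * x - int i"
      using i False by (auto simp: d_k_def of_nat_diff)
    have "height s = - 2 * int d" "(x, - x) = s + (int d + \<epsilon> * int k, int d - \<epsilon> * int k)"
      using eps by (auto simp: s_eq d k height_def)
    from sum_initial_paths[OF eps this] show ?thesis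
      using False unfolding \<epsilon>_def[symmetric] series d(2) by (simp add: d_k_def(2))
  qed
qed

subsection \<open>Final segments\<close>

definition final_paths :: "point \<Rightarrow> point \<Rightarrow> point list set" where
  "final_paths = paths_within {(1, 0), (0, 1)} UNIV"

definition right_step_weight :: "'a::field \<Rightarrow> nat \<Rightarrow> int \<Rightarrow> 'a" where
  "right_step_weight w j h = (if h \<ge> int j - 1 then w else 1)"

definition final_poly :: "(int \<Rightarrow> 'a::comm_ring_1) \<Rightarrow> int \<Rightarrow> nat \<Rightarrow> 'a poly" where
  "final_poly c h m = (\<Prod>t<m. [:1, c (h + int t):])"

lemma final_poly_Suc: "final_poly c h (Suc m) = [:1, c h:] * final_poly c (h + 1) m"
  unfolding final_poly_def
  by (subst prod.lessThan_Suc_shift) (simp add: algebra_simps del: mult_pCons_left)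

lemma final_poly_add: "final_poly c h (a + b) = final_poly c h a * final_poly c (h + int a) b"
  by (induction a arbitrary: h)
    (simp_all add: final_poly_Suc mult.assoc add_ac final_poly_def[of _ _ 0] del: mult_pCons_left)

lemma degree_final_poly: "degree (final_poly c h m) \<le> m"
proof -
  have "degree (final_poly c h m) \<le> (\<Sum>t<m. degree [:1, c (h + int t):])"
    unfolding final_poly_def
    using degree_prod_sum_le[of "{..<m}" "\<lambda>t. [:1, c (h + int t):]"] by (simp add: comp_def)
  also have "\<dots> \<le> (\<Sum>t<m. 1)"
    by (intro sum_mono) simp
  finally show ?thesis by simp
qed

lemma coeff_linear_mult:
  fixes c :: "'a::comm_ring_1"
  shows "coeff ([:1, c:] * p) k = coeff p k + (if k = 0 then 0 else c * coeff p (k - 1))"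
  by (cases k) simp_all

lemma final_paths_mono:
  assumes "p \<in> final_paths a b"
  shows "fst a \<le> fst b" "snd a \<le> snd b" "height a \<le> height b"
proof -
  note mono = paths_within_mono[OF assms[unfolded final_paths_def]]
  show "fst a \<le> fst b" by (rule mono) auto
  show "snd a \<le> snd b" by (rule mono) auto
  show "height a \<le> height b" by (rule mono[where f = height]) (auto simp: height_def)
qed

lemma sum_final_paths_step:
  assumes "finite (final_paths (a + (1, 0)) b) \<and>
      (\<Sum>p\<in>final_paths (a + (1, 0)) b. segment_weight X w j p) = W"
    and "finite (final_paths (a + (0, 1)) b) \<and>
      (\<Sum>p\<in>final_paths (a + (0, 1)) b. segment_weight X w j p) = W'"
  shows "finite (final_paths a b) \<and> (\<Sum>p\<in>final_paths a b. segment_weight X w j p) =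
    of_bool (a = b) + right_step_weight w j (height a) * W + W'"
proof -
  have "step_weight X w j a (a + (1, 0)) = right_step_weight w j (height a)"
    "step_weight X w j a (a + (0, 1)) = 1"
    by (auto simp: step_weight_def right_step_weight_def)
  then show ?thesis
    using sum_paths_within_two_steps[of a UNIV "(1, 0)" "(0, 1)" b X w j W W'] assms
    by (simp add: final_paths_def)
qed

lemma sum_final_paths:
  assumes "b = a + (int k, int m - int k)"
  shows "finite (final_paths a b) \<and>
    (\<Sum>p\<in>final_paths a b. segment_weight X w j p) =
      coeff (final_poly (right_step_weight w j) (height a) m) k"
  using assms
proof (induction m arbitrary: a k)
  case 0
  have "final_paths (a + s) b = {}" if "s \<in> {(1, 0), (0, 1)}" for s
    using final_paths_mono(3)[of _ "a + s" b] 0 that by (auto simp: height_def)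
  moreover have "a = b \<longleftrightarrow> k = 0"
    using 0 by (auto simp: prod_eq_iff)
  ultimately show ?case
    using sum_final_paths_step[of a b X w j 0 0] by (simp add: final_poly_def)
next
  case (Suc m)
  let ?W = "\<lambda>a. \<Sum>p\<in>final_paths a b. segment_weight X w j p"
  let ?q = "final_poly (right_step_weight w j) (height a + 1) m"
  have "finite (final_paths (a + (0, 1)) b) \<and> ?W (a + (0, 1)) = coeff ?q k"
    using Suc.IH[of "a + (0, 1)" k] Suc.prems by (simp add: height_def algebra_simps)
  moreover have "finite (final_paths (a + (1, 0)) b) \<and>
      ?W (a + (1, 0)) = (if k = 0 then 0 else coeff ?q (k - 1))"
  proof (cases k)
    case 0
    then have "final_paths (a + (1, 0)) b = {}"
      using final_paths_mono(1)[of _ "a + (1, 0)" b] Suc.prems by auto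
    with 0 show ?thesis by simp
  next
    case (Suc k')
    then show ?thesis
      using Suc.IH[of "a + (1, 0)" k'] Suc.prems by (simp add: height_def algebra_simps)
  qed
  moreover have "a \<noteq> b" using Suc.prems by (auto simp: prod_eq_iff)
  ultimately show ?case
    using sum_final_paths_step[of a b X w j] unfolding final_poly_Suc coeff_linear_mult by simp
qed

subsection \<open>Admissible paths\<close>

lemma admissible_pathsD:
  assumes "\<pi> \<in> admissible_paths i s e"
  shows "lattice_path (initial_steps i s) s (last (fst \<pi>)) (fst \<pi>)"
    and "height (last (fst \<pi>)) = 0" and "\<forall>u\<in>set (fst \<pi>). height u \<le> 0"
    and "lattice_path {(1, 0), (0, 1)} (last (fst \<pi>)) e (snd \<pi>)"
  using assms by (auto simp: admissible_paths_def lattice_path_def)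

lemma admissible_pathsI:
  assumes "lattice_path (initial_steps i s) s P p" "height P = 0" "\<forall>u\<in>set p. height u \<le> 0"
    "lattice_path {(1, 0), (0, 1)} P e q"
  shows "(p, q) \<in> admissible_paths i s e"
  unfolding admissible_paths_def using assms by blast

lemma admissible_paths_eq_Union:
  assumes i: "i \<ge> 1" and s: "s \<in> {alpha i, beta i}" and e: "height e = int H"
  defines "P \<equiv> \<lambda>t. (fst e - int t, int t - fst e)"
  shows "admissible_paths i s e = (\<Union>t\<le>H. initial_paths (side i s) s (P t) \<times> final_paths (P t) e)"
proof (rule subset_antisym; rule subsetI)
  note steps = initial_steps_side[OF i s]
  fix \<pi> assume \<pi>: "\<pi> \<in> admissible_paths i s e"
  define Q where "Q = last (fst \<pi>)"
  have Q: "height Q = 0" and initial: "fst \<pi> \<in> initial_paths (side i s) s Q"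
    and final: "snd \<pi> \<in> final_paths Q e"
    using admissible_pathsD[OF \<pi>]
    by (auto simp: steps initial_paths_def final_paths_def paths_within_def Q_def)
  have "fst Q \<le> fst e" "snd Q \<le> snd e"
    using final_paths_mono[OF final] by simp_all
  with Q e have "Q = P (nat (fst e - fst Q))" "nat (fst e - fst Q) \<le> H"
    by (auto simp: P_def height_def prod_eq_iff)
  with initial final show "\<pi> \<in> (\<Union>t\<le>H. initial_paths (side i s) s (P t) \<times> final_paths (P t) e)"
    by (intro UN_I[of "nat (fst e - fst Q)"]) (auto simp: mem_Times_iff)
next
  note steps = initial_steps_side[OF i s]
  fix \<pi> assume "\<pi> \<in> (\<Union>t\<le>H. initial_paths (side i s) s (P t) \<times> final_paths (P t) e)"
  then obtain p q t where "\<pi> = (p, q)" "p \<in> initial_paths (side i s) s (P t)"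
      "q \<in> final_paths (P t) e"
    by blast
  then show "\<pi> \<in> admissible_paths i s e"
    using admissible_pathsI[of i s "P t" p e q]
    by (auto simp: P_def height_def steps initial_paths_def final_paths_def paths_within_def)
qed

lemma sum_admissible_paths:
  assumes i: "i \<ge> 1" and s: "s \<in> {alpha i, beta i}" and X: "\<And>t. t \<in> {1..i} \<Longrightarrow> X t \<noteq> 0"
    and e: "height e = int H"
  shows "finite (admissible_paths i s e) \<and> (\<Sum>\<pi>\<in>admissible_paths i s e. path_weight X w j \<pi>) =
      (\<Sum>t\<le>H. coeff (final_poly (right_step_weight w j) 0 H) t *
         fls_nth (start_series X i) (side i s * (fst e - int t)))"
proof -
  define P where "P t = (fst e - int t, int t - fst e)" for t
  let ?A = "\<lambda>t. initial_paths (side i s) s (P t)" and ?B = "\<lambda>t. final_paths (P t) e"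
  have A: "finite (?A t) \<and> (\<Sum>p\<in>?A t. segment_weight X w j p) =
      fls_nth (start_series X i) (side i s * (fst e - int t))" for t
    using sum_initial_paths_from_start[OF i s X, where x = "fst e - int t"] by (simp add: P_def)
  have B: "finite (?B t) \<and> (\<Sum>q\<in>?B t. segment_weight X w j q) =
      coeff (final_poly (right_step_weight w j) 0 H) t" for t
  proof -
    have "e = P t + (int t, int H - int t)" "height (P t) = 0"
      using e by (auto simp: P_def height_def prod_eq_iff)
    with sum_final_paths[OF this(1)] show ?thesis by simp
  qed
  have fin: "finite (?A t \<times> ?B t)" for t
    using A[of t] B[of t] by simp
  note Un = admissible_paths_eq_Union[OF i s e, folded P_def]
  have "(\<Sum>\<pi>\<in>admissible_paths i s e. path_weight X w j \<pi>) =
      (\<Sum>t\<le>H. \<Sum>\<pi>\<in>?A t \<times> ?B t. path_weight X w j \<pi>)"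
    unfolding Un
  proof (rule sum.UNION_disjoint)
    have "t = t'" if "q \<in> ?B t" "q \<in> ?B t'" for q t t'
      using that[unfolded final_paths_def, THEN hd_paths_within] by (simp add: P_def)
    then show "\<forall>t\<in>{..H}. \<forall>t'\<in>{..H}. t \<noteq> t' \<longrightarrow> (?A t \<times> ?B t) \<inter> (?A t' \<times> ?B t') = {}"
      by blast
  qed (use fin in auto)
  also have "\<dots> = (\<Sum>t\<le>H. (\<Sum>p\<in>?A t. segment_weight X w j p) * (\<Sum>q\<in>?B t. segment_weight X w j q))"
    by (simp add: sum_product sum.cartesian_product path_weight_def case_prod_unfold)
  finally show ?thesis
    unfolding Un using A B fin by (simp add: mult.commute)
qed

lemma finite_admissible_paths:
  assumes "i \<ge> 1" "s \<in> {alpha i, beta i}" "height e \<ge> 0"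
  shows "finite (admissible_paths i s e)"
  using sum_admissible_paths[OF assms(1,2), of "\<lambda>_. 1 :: rat" e "nat (height e)"] assms(3) by simp

definition signed_path_sum :: "(nat \<Rightarrow> 'a::field) \<Rightarrow> 'a \<Rightarrow> nat \<Rightarrow> nat \<Rightarrow> point \<Rightarrow> 'a" where
  "signed_path_sum X w i j e =
    (\<Sum>s\<in>{alpha i, beta i}. of_int (- side i s) * (\<Sum>\<pi>\<in>admissible_paths i s e. path_weight X w j \<pi>))"

lemma signed_path_sum_eq_antisym_coeff:
  assumes i: "i \<ge> 1" and X: "\<And>t. t \<in> {1..i} \<Longrightarrow> X t \<noteq> 0" and e: "height e = int H"
  shows "signed_path_sum X w i j e =
    antisym_coeff (final_poly (right_step_weight w j) 0 H) (start_series X i) (fst e)"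
proof -
  have "side i (alpha i) = -1" "side i (beta i) = 1"
    using alpha_neq_beta[OF i] by (simp_all add: side_def)
  then show ?thesis
    using alpha_neq_beta[OF i] sum_admissible_paths[OF i _ X e]
    by (simp add: signed_path_sum_def antisym_coeff_altdef[OF degree_final_poly]
      right_diff_distrib sum_subtractf)
qed

definition end_poly :: "'a::comm_ring_1 \<Rightarrow> nat \<Rightarrow> nat \<Rightarrow> 'a poly" where
  "end_poly w n j = [:1, 1:] ^ (j - 1) * [:1, w:] ^ (n - j)"

lemma final_poly_below_threshold:
  assumes "j \<ge> 1"
  shows "final_poly (right_step_weight w j) 0 (j - 1) = [:1, 1:] ^ (j - 1)"
proof -
  have "final_poly (right_step_weight w j) 0 (j - 1) = (\<Prod>t<j - 1. [:1, 1:])"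
    unfolding final_poly_def using assms by (intro prod.cong) (auto simp: right_step_weight_def)
  then show ?thesis by simp
qed

lemma final_poly_eq_end_poly:
  assumes "j \<in> {1..n}"
  shows "final_poly (right_step_weight w j) 0 (n - 1) = end_poly w n j"
proof -
  have n: "n - 1 = (j - 1) + (n - j)" using assms by auto
  have "final_poly (right_step_weight w j) (int (j - 1)) (n - j) = [:1, w:] ^ (n - j)"
    using assms by (simp add: final_poly_def right_step_weight_def of_nat_diff)
  then show ?thesis
    unfolding n final_poly_add end_poly_def using assms final_poly_below_threshold[of j w] by simp
qed

lemma signed_path_sum_eq_end_poly:
  assumes i: "i \<in> {1..n}" and j: "j \<in> {1..n}" and X: "\<And>s. s \<in> {1..n} \<Longrightarrow> X s \<noteq> 0"
    and e: "height e = int n - 1 \<or> w = 0 \<and> height e = int j - 1"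
  shows "signed_path_sum X w i j e = antisym_coeff (end_poly w n j) (start_series X i) (fst e)"
  using e
proof (elim disjE conjE)
  assume "height e = int n - 1"
  then have "height e = int (n - 1)" using i by auto
  then show ?thesis
    using signed_path_sum_eq_antisym_coeff[of i X e "n - 1" w j] i X
      final_poly_eq_end_poly[OF j, of w] by simp
next
  assume w: "w = 0" and "height e = int j - 1"
  then have "height e = int (j - 1)" using j by auto
  moreover have "final_poly (right_step_weight w j) 0 (j - 1) = end_poly w n j"
    using j final_poly_below_threshold[of j w] by (simp add: end_poly_def w flip: one_pCons)
  ultimately show ?thesis
    using signed_path_sum_eq_antisym_coeff[of i X e "j - 1" w j] i X by simp
qed

subsection \<open>The signed sum over all families\<close>

abbreviation (input) signed_weight :: "(nat \<Rightarrow> 'a::field) \<Rightarrow> 'a \<Rightarrow> nat \<Rightarrow> family \<Rightarrow> 'a" where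
  "signed_weight X w n F \<equiv> of_int (family_sign n F) * family_weight X w n F"

type_synonym strand = "point \<times> point \<times> path"

definition strands :: "(nat \<Rightarrow> point set) \<Rightarrow> nat \<Rightarrow> nat \<Rightarrow> strand set" where
  "strands E i j = (SIGMA s:{alpha i, beta i}. SIGMA e:E j. admissible_paths i s e)"

definition strand_weight :: "(nat \<Rightarrow> 'a::field) \<Rightarrow> 'a \<Rightarrow> nat \<Rightarrow> nat \<Rightarrow> strand \<Rightarrow> 'a" where
  "strand_weight X w i j = (\<lambda>(s, e, \<pi>). of_int (- side i s) * path_weight X w j \<pi>)"

definition family_of :: "nat \<Rightarrow> (nat \<Rightarrow> nat) \<times> (nat \<Rightarrow> strand) \<Rightarrow> family" where
  "family_of n = (\<lambda>(\<sigma>, g). \<lparr>perm = \<sigma>, start = (\<lambda>i\<in>{1..n}. fst (g i)),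
    endpoint = (\<lambda>i\<in>{1..n}. fst (snd (g i))), paths = (\<lambda>i\<in>{1..n}. snd (snd (g i)))\<rparr>)"

lemma finite_strands:
  assumes "i \<ge> 1" "finite (E j)" "\<And>e. e \<in> E j \<Longrightarrow> height e \<ge> 0"
  shows "finite (strands E i j)"
  unfolding strands_def using assms by (intro finite_SigmaI finite_admissible_paths) auto

lemma sum_strand_weight:
  assumes "i \<ge> 1" "finite (E j)" "\<And>e. e \<in> E j \<Longrightarrow> height e \<ge> 0"
  shows "(\<Sum>y\<in>strands E i j. strand_weight X w i j y) = (\<Sum>e\<in>E j. signed_path_sum X w i j e)"
proof -
  have "(\<Sum>y\<in>strands E i j. strand_weight X w i j y) =
      (\<Sum>s\<in>{alpha i, beta i}. \<Sum>e\<in>E j. \<Sum>\<pi>\<in>admissible_paths i s e.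
        of_int (- side i s) * path_weight X w j \<pi>)"
    unfolding strands_def strand_weight_def using assms finite_admissible_paths[OF assms(1)]
    by (simp add: sum.Sigma[symmetric] finite_SigmaI del: sum.insert of_int_minus)
  also have "\<dots> = (\<Sum>e\<in>E j. signed_path_sum X w i j e)"
    unfolding signed_path_sum_def sum_distrib_left by (rule sum.swap)
  finally show ?thesis .
qed

lemma bij_betw_family_of:
  "bij_betw (family_of n) (SIGMA \<sigma>:{\<sigma>. \<sigma> permutes {1..n}}. \<Pi>\<^sub>E i\<in>{1..n}. strands E i (\<sigma> i))
      (families n E)"
  (is "bij_betw _ ?A _")
proof (rule bij_betw_byWitness[where
      f' = "\<lambda>F. (perm F, \<lambda>i\<in>{1..n}. (start F i, endpoint F i, paths F i))"])
  show "\<forall>x\<in>?A. (\<lambda>F. (perm F, \<lambda>i\<in>{1..n}. (start F i, endpoint F i, paths F i))) (family_of n x) = x"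
    by (auto simp: family_of_def PiE_iff extensional_def)
  show "\<forall>F\<in>families n E. family_of n (perm F, \<lambda>i\<in>{1..n}. (start F i, endpoint F i, paths F i)) = F"
    by (auto simp: family_of_def families_def PiE_iff extensional_def intro!: family.equality)
  show "family_of n ` ?A \<subseteq> families n E"
    by (force simp: family_of_def families_def strands_def PiE_iff)
  show "(\<lambda>F. (perm F, \<lambda>i\<in>{1..n}. (start F i, endpoint F i, paths F i))) ` families n E \<subseteq> ?A"
    by (auto simp: families_def strands_def PiE_iff)
qed

lemma family_sign_eq_prod_side:
  "family_sign n F = sign (perm F) * (\<Prod>i=1..n. - side i (start F i))"
  by (simp add: family_sign_def side_def if_distrib[of uminus] prod.If_cases Int_def)

lemma signed_weight_family_of:
  "signed_weight X w n (family_of n (\<sigma>, g)) =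
    of_int (sign \<sigma>) * (\<Prod>i=1..n. strand_weight X w i (\<sigma> i) (g i))"
  by (simp add: family_sign_eq_prod_side family_weight_def family_of_def strand_weight_def
      case_prod_unfold of_int_prod prod.distrib del: of_int_minus)

lemma
  assumes E: "\<And>j. j \<in> {1..n} \<Longrightarrow> finite (E j)" "\<And>j e. j \<in> {1..n} \<Longrightarrow> e \<in> E j \<Longrightarrow> height e \<ge> 0"
  shows finite_families: "finite (families n E)"
    and sum_families: "(\<Sum>F\<in>families n E. signed_weight X w n F) =
      det_on {1..n} (\<lambda>i j. \<Sum>e\<in>E j. signed_path_sum X w i j e)"
proof -
  let ?G = "\<lambda>\<sigma>. \<Pi>\<^sub>E i\<in>{1..n}. strands E i (\<sigma> i)"
  have strands: "finite (strands E i j)" if "i \<in> {1..n}" "j \<in> {1..n}" for i j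
    using that E by (intro finite_strands) auto
  have "finite (?G \<sigma>)" if "\<sigma> permutes {1..n}" for \<sigma>
    using permutes_in_image[OF that] by (intro finite_PiE strands) auto
  then have fin: "finite {\<sigma>. \<sigma> permutes {1..n}}" "\<forall>\<sigma>\<in>{\<sigma>. \<sigma> permutes {1..n}}. finite (?G \<sigma>)"
    by (simp_all add: finite_permutations)
  then have "finite (SIGMA \<sigma>:{\<sigma>. \<sigma> permutes {1..n}}. ?G \<sigma>)"
    by (intro finite_SigmaI) auto
  then show "finite (families n E)"
    by (simp add: bij_betw_finite[OF bij_betw_family_of, symmetric])
  have "(\<Sum>F\<in>families n E. signed_weight X w n F) =
      (\<Sum>(\<sigma>, g)\<in>(SIGMA \<sigma>:{\<sigma>. \<sigma> permutes {1..n}}. ?G \<sigma>). signed_weight X w n (family_of n (\<sigma>, g)))"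
    by (subst sum.reindex_bij_betw[OF bij_betw_family_of, symmetric]) (simp add: case_prod_unfold)
  also have "\<dots> = (\<Sum>\<sigma> | \<sigma> permutes {1..n}. \<Sum>g\<in>?G \<sigma>.
      of_int (sign \<sigma>) * (\<Prod>i=1..n. strand_weight X w i (\<sigma> i) (g i)))"
    unfolding signed_weight_family_of by (rule sum.Sigma[symmetric, OF fin])
  also have "\<dots> = det_on {1..n} (\<lambda>i j. \<Sum>y\<in>strands E i j. strand_weight X w i j y)"
    by (rule det_on_sum[symmetric]) (auto simp: strands)
  also have "\<dots> = det_on {1..n} (\<lambda>i j. \<Sum>e\<in>E j. signed_path_sum X w i j e)"
    by (rule det_on_cong) (auto simp: E intro!: sum_strand_weight)
  finally show "(\<Sum>F\<in>families n E. signed_weight X w n F) =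
      det_on {1..n} (\<lambda>i j. \<Sum>e\<in>E j. signed_path_sum X w i j e)" .
qed

subsection \<open>The determinant of \<open>R\<close>\<close>

definition parity_factor :: "nat \<Rightarrow> 'a::field \<Rightarrow> 'a" where
  "parity_factor m x = (if odd m then 1 + x else 1)"

definition abscissae :: "nat \<Rightarrow> nat \<Rightarrow> nat \<Rightarrow> int set" where
  "abscissae n m j =
    (let T = int n - int j + int (m div 2) + 1 in if odd m then {T} else {T, T - 1})"

lemma finite_abscissae: "finite (abscissae n m j)"
  by (simp add: abscissae_def Let_def)

definition end_coeff :: "'a::field \<Rightarrow> nat \<Rightarrow> nat \<Rightarrow> nat \<Rightarrow> 'a fls \<Rightarrow> 'a" where
  "end_coeff w n m j f = (\<Sum>T\<in>abscissae n m j. antisym_coeff (end_poly w n j) f T)"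

lemma R_entry_eq_end_poly:
  "R_entry X w n m i j = X i ^ (j - 1) * poly (end_poly w n j) (X i) -
    X i ^ (m + 2 * n - j) * poly (end_poly w n j) (inverse (X i))"
  by (simp add: R_entry_def end_poly_def mult_ac)

lemma power_mult_powi:
  fixes x :: "'a::field"
  assumes "x \<noteq> 0" "int a + b = int c"
  shows "x ^ a * x powi b = x ^ c"
  using assms by (metis power_int_add power_int_of_nat)

lemma R_entry_odd:
  fixes X :: "nat \<Rightarrow> 'a::field" and n j l :: nat
  assumes X: "X i \<noteq> 0" and j: "j \<in> {1..n}"
  defines "T \<equiv> int n - int j + int l + 1"
  shows "R_entry X w n (2 * l + 1) i j = X i ^ (n + l - 1) * ((X i - 1) * (1 + X i)) *
    antisym_coeff (end_poly w n j) (resolvent (node X i)) T"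
    (is "_ = ?x ^ _ * _ * ?c")
proof -
  let ?p = "end_poly w n j"
  have "?x ^ (n + l - 1) * ((?x - 1) * (1 + ?x)) = ?x ^ (n + l) * (?x - inverse ?x)"
    using X j by (cases "n + l") (auto simp: field_simps)
  then have "?x ^ (n + l - 1) * ((?x - 1) * (1 + ?x)) * ?c =
      ?x ^ (n + l) * ((?x - inverse ?x) * ?c)"
    by (simp only: mult.assoc)
  also have "\<dots> = ?x ^ (n + l) * ?x powi (- T) * poly ?p ?x -
      ?x ^ (n + l) * ?x powi T * poly ?p (inverse ?x)"
    unfolding node_def antisym_coeff_resolvent[OF X] by (simp only: right_diff_distrib mult.assoc)
  also have "?x ^ (n + l) * ?x powi (- T) = ?x ^ (j - 1)"
    using j by (intro power_mult_powi X) (auto simp: T_def)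
  also have "?x ^ (n + l) * ?x powi T = ?x ^ (2 * l + 1 + 2 * n - j)"
    using j by (intro power_mult_powi X) (auto simp: T_def)
  finally show ?thesis
    by (simp only: R_entry_eq_end_poly)
qed

lemma R_entry_even:
  fixes X :: "nat \<Rightarrow> 'a::field" and n j l :: nat
  assumes X: "X i \<noteq> 0" and j: "j \<in> {1..n}"
  defines "T \<equiv> int n - int j + int l + 1" and "r \<equiv> resolvent (node X i)"
  shows "R_entry X w n (2 * l) i j = X i ^ (n + l - 1) * (X i - 1) *
    (antisym_coeff (end_poly w n j) r T + antisym_coeff (end_poly w n j) r (T - 1))"
    (is "_ = ?x ^ ?N * _ * ?c")
proof -
  let ?p = "end_poly w n j"
  have "?x ^ ?N * (?x - 1) * ?c = ?x ^ ?N * ((?x - 1) * ?c)"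
    by (simp only: mult.assoc)
  also have "\<dots> = ?x ^ ?N * ?x powi (1 - T) * poly ?p ?x -
      ?x ^ ?N * ?x powi T * poly ?p (inverse ?x)"
    unfolding r_def node_def antisym_coeff_resolvent_pair[OF X]
    by (simp only: right_diff_distrib mult.assoc)
  also have "?x ^ ?N * ?x powi (1 - T) = ?x ^ (j - 1)"
    using j by (intro power_mult_powi X) (auto simp: T_def)
  also have "?x ^ ?N * ?x powi T = ?x ^ (2 * l + 2 * n - j)"
    using j by (intro power_mult_powi X) (auto simp: T_def)
  finally show ?thesis
    by (simp only: R_entry_eq_end_poly)
qed

lemma R_entry_eq_end_coeff:
  fixes X :: "nat \<Rightarrow> 'a::field"
  assumes "X i \<noteq> 0" "j \<in> {1..n}"
  shows "R_entry X w n m i j = X i ^ (n + m div 2 - 1) * ((X i - 1) * parity_factor m (X i)) *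
    end_coeff w n m j (resolvent (node X i))"
proof (cases "odd m")
  case True
  then obtain l where m: "m = 2 * l + 1" by (rule oddE)
  show ?thesis
    unfolding m using assms R_entry_odd[of X i j n w l]
    by (simp add: end_coeff_def abscissae_def parity_factor_def)
next
  case False
  then obtain l where m: "m = 2 * l" by (auto elim: evenE)
  show ?thesis
    unfolding m using assms R_entry_even[of X i j n w l]
    by (simp add: end_coeff_def abscissae_def parity_factor_def)
qed

lemma prod_pairs_mult:
  fixes y :: "nat \<Rightarrow> 'a::comm_semiring_1"
  shows "(\<Prod>j=1..n. \<Prod>i\<in>{1..<j}. y i * y j) = (\<Prod>i=1..n. y i ^ (n - 1))"
proof (induction n)
  case (Suc n)
  have last_factor: "(\<Prod>j=1..Suc n. g j) = (\<Prod>j=1..n. g j) * g (Suc n)" for g :: "nat \<Rightarrow> 'a"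
    by simp
  have "(\<Prod>i=1..n. y i ^ n) = (\<Prod>i=1..n. y i ^ (n - 1)) * (\<Prod>i=1..n. y i)"
    by (cases n) (simp_all add: prod.distrib mult_ac)
  moreover have "(\<Prod>i\<in>{1..<Suc n}. y i * y (Suc n)) = (\<Prod>i=1..n. y i) * y (Suc n) ^ n"
    unfolding atLeastLessThanSuc_atLeastAtMost by (simp add: prod.distrib)
  ultimately show ?case
    unfolding last_factor Suc by (simp add: mult.assoc)
qed simp

lemma prod_pairs_const:
  "(\<Prod>j=1..n. \<Prod>i\<in>{1..<j}. c) = (c ^ (n choose 2) :: 'a::comm_semiring_1)"
proof (induction n)
  case (Suc n)
  have "Suc n choose 2 = (n choose 2) + n"
    by (simp add: numeral_2_eq_2)
  moreover have "(\<Prod>j=1..Suc n. g j) = (\<Prod>j=1..n. g j) * g (Suc n)" for g :: "nat \<Rightarrow> 'a"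
    by simp
  ultimately show ?case
    by (simp only: Suc power_add) simp
qed (simp add: numeral_2_eq_2)

lemma prod_pairs_swap:
  fixes n :: nat
  shows "(\<Prod>i=1..n. \<Prod>j=i+1..n. f i j) = (\<Prod>j=1..n. \<Prod>i\<in>{1..<j}. f i j)"
proof -
  have "(\<Prod>(i, j)\<in>Sigma {1..n} (\<lambda>i. {i+1..n}). f i j) = (\<Prod>(j, i)\<in>Sigma {1..n} (\<lambda>j. {1..<j}). f i j)"
    by (rule prod.reindex_bij_witness[of _ prod.swap prod.swap]) auto
  then show ?thesis
    by (simp add: prod.Sigma)
qed

definition vandermonde :: "nat \<Rightarrow> (nat \<Rightarrow> 'a::comm_ring_1) \<Rightarrow> 'a" where
  "vandermonde n v = (\<Prod>j=1..n. \<Prod>i\<in>{1..<j}. v j - v i)"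

definition R_denominator :: "nat \<Rightarrow> (nat \<Rightarrow> 'a::field) \<Rightarrow> 'a" where
  "R_denominator n X =
    (\<Prod>i=1..n. 1 - X i) * (\<Prod>i=1..n. \<Prod>j=i+1..n. (1 - X i * X j) * (X j - X i))"

lemma vandermonde_node:
  fixes X :: "nat \<Rightarrow> 'a::field"
  assumes "\<forall>i\<in>{1..n}. X i \<noteq> 0"
  shows "(\<Prod>i=1..n. X i ^ (n - 1)) * vandermonde n (node X) =
    (-1) ^ (n choose 2) * (\<Prod>i=1..n. \<Prod>j=i+1..n. (1 - X i * X j) * (X j - X i))"
proof -
  have "(\<Prod>i=1..n. X i ^ (n - 1)) * vandermonde n (node X) =
      (\<Prod>j=1..n. \<Prod>i\<in>{1..<j}. X i * X j * (node X j - node X i))"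
    by (simp only: vandermonde_def prod.distrib prod_pairs_mult[symmetric])
  also have "\<dots> = (\<Prod>j=1..n. \<Prod>i\<in>{1..<j}. -1 * ((1 - X i * X j) * (X j - X i)))"
    using assms by (intro prod.cong refl) (auto simp: node_def field_simps)
  also have "\<dots> = (-1) ^ (n choose 2) * (\<Prod>j=1..n. \<Prod>i\<in>{1..<j}. (1 - X i * X j) * (X j - X i))"
    by (simp only: prod.distrib prod_pairs_const)
  finally show ?thesis
    by (simp only: prod_pairs_swap)
qed

lemma row_factors_mult_vandermonde:
  fixes X \<rho> :: "nat \<Rightarrow> 'a::field"
  assumes X: "\<forall>i\<in>{1..n}. X i \<noteq> 0"
  shows "(\<Prod>i=1..n. X i ^ (n + l - 1) * ((X i - 1) * \<rho> i)) * vandermonde n (node X) =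
    (-1) ^ ((n + 1) choose 2) * (\<Prod>i=1..n. X i ^ l * \<rho> i) * R_denominator n X"
proof -
  let ?Y = "\<Prod>i=1..n. X i ^ (n - 1)" and ?Q = "\<Prod>i=1..n. 1 - X i"
    and ?C = "\<Prod>i=1..n. X i ^ l * \<rho> i"
  have "(\<Prod>i=1..n. X i ^ (n + l - 1) * ((X i - 1) * \<rho> i)) =
      (\<Prod>i=1..n. -1 * (1 - X i) * (X i ^ l * \<rho> i) * X i ^ (n - 1))"
    by (intro prod.cong refl) (cases n; simp add: power_add algebra_simps)
  also have "\<dots> = (\<Prod>i=1..n. -1) * ?Q * ?C * ?Y"
    by (simp only: prod.distrib)
  finally have "(\<Prod>i=1..n. X i ^ (n + l - 1) * ((X i - 1) * \<rho> i)) * vandermonde n (node X) =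
      (\<Prod>i=1..n. -1) * ?Q * ?C * (?Y * vandermonde n (node X))"
    by (simp only: mult.assoc)
  also have "\<dots> = ((\<Prod>i=1..n. -1) * (-1) ^ (n choose 2)) * ?C * R_denominator n X"
    unfolding vandermonde_node[OF X] R_denominator_def by (simp only: mult_ac)
  also have "(\<Prod>i=1..n. -1) * (-1) ^ (n choose 2) = ((-1) ^ ((n + 1) choose 2) :: 'a)"
    by (simp add: numeral_2_eq_2 power_add)
  finally show ?thesis .
qed

lemma end_coeff_newton:
  fixes r :: nat
  assumes "r \<ge> 1"
  shows "end_coeff w n m j (resolvent (node X r)) =
    (\<Sum>k=1..r. (\<Prod>s\<in>{1..<k}. node X r - node X s) * end_coeff w n m j (start_series X k))"
proof -
  have "end_coeff w n m j (resolvent (node X r)) = (\<Sum>T\<in>abscissae n m j. \<Sum>k=1..r.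
      (\<Prod>s\<in>{1..<k}. node X r - node X s) * antisym_coeff (end_poly w n j) (start_series X k) T)"
    unfolding end_coeff_def resolvent_newton[OF assms, of "node X"] antisym_coeff_linear_combination
    by (simp add: start_series_def)
  also have "\<dots> =
      (\<Sum>k=1..r. (\<Prod>s\<in>{1..<k}. node X r - node X s) * end_coeff w n m j (start_series X k))"
    unfolding end_coeff_def sum_distrib_left by (rule sum.swap)
  finally show ?thesis .
qed

lemma det_R_entry:
  fixes X :: "nat \<Rightarrow> 'a::field"
  assumes X: "\<forall>i\<in>{1..n}. X i \<noteq> 0"
  shows "det_on {1..n} (R_entry X w n m) =
    (\<Prod>i=1..n. X i ^ (n + m div 2 - 1) * ((X i - 1) * parity_factor m (X i))) *
    (vandermonde n (node X) * det_on {1..n} (\<lambda>i j. end_coeff w n m j (start_series X i)))"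
proof -
  have "det_on {1..n} (R_entry X w n m) =
      (\<Prod>i=1..n. X i ^ (n + m div 2 - 1) * ((X i - 1) * parity_factor m (X i))) *
      det_on {1..n} (\<lambda>i j. end_coeff w n m j (resolvent (node X i)))"
    unfolding det_on_scale_rows[symmetric] using X
    by (intro det_on_cong R_entry_eq_end_coeff) auto
  also have "det_on {1..n} (\<lambda>i j. end_coeff w n m j (resolvent (node X i))) =
      vandermonde n (node X) * det_on {1..n} (\<lambda>i j. end_coeff w n m j (start_series X i))"
    unfolding vandermonde_def
    by (rule det_on_lower_triangular_mult[where b = "\<lambda>i k. \<Prod>s\<in>{1..<k}. node X i - node X s"])
      (auto simp: end_coeff_newton)
  finally show ?thesis .
qed

lemma R_denominator_nonzero:
  assumes "generic n X"
  shows "R_denominator n X \<noteq> 0"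
proof -
  have "1 - X i \<noteq> 0" if "i \<in> {1..n}" for i
    using assms that by (auto simp: generic_def)
  moreover have "(1 - X i * X j) * (X j - X i) \<noteq> 0" if "i \<in> {1..n}" "j \<in> {i+1..n}" for i j
  proof -
    have "i < j" "j \<in> {1..n}" using that by auto
    with assms that(1) have "X i * X j \<noteq> 1" "X i \<noteq> X j"
      unfolding generic_def by blast+
    then show ?thesis by simp
  qed
  ultimately show ?thesis
    by (simp only: R_denominator_def mult_eq_0_iff prod_zero_iff finite_atLeastAtMost) blast
qed

definition prefactor :: "(nat \<Rightarrow> 'a::field) \<Rightarrow> 'a \<Rightarrow> nat \<Rightarrow> nat \<Rightarrow> 'a" where
  "prefactor X w n m =
    (\<Prod>i=1..n. X i ^ (m div 2) * (inverse (X i) + 1 + w + X i) * parity_factor m (X i))"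

lemma R_eq_det_on:
  fixes X :: "nat \<Rightarrow> 'a::field"
  assumes "generic n X"
  shows "R X w n m = (-1) ^ ((n + 1) choose 2) * prefactor X w n m *
    det_on {1..n} (\<lambda>i j. end_coeff w n m j (start_series X i))"
proof -
  define M where "M = det_on {1..n} (\<lambda>i j. end_coeff w n m j (start_series X i))"
  define C where "C = (\<Prod>i=1..n. X i ^ (m div 2) * parity_factor m (X i))"
  have X: "\<forall>i\<in>{1..n}. X i \<noteq> 0"
    using assms by (simp add: generic_def)
  have "det_on {1..n} (R_entry X w n m) = (-1) ^ ((n + 1) choose 2) * C * R_denominator n X * M"
    unfolding M_def C_def row_factors_mult_vandermonde[OF X, symmetric] det_R_entry[OF X]
    by (simp only: mult.assoc)
  then have "det_on {1..n} (R_entry X w n m) / R_denominator n X =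
      (-1) ^ ((n + 1) choose 2) * C * M"
    using R_denominator_nonzero[OF assms] by simp
  moreover have "prefactor X w n m = (\<Prod>i=1..n. inverse (X i) + 1 + w + X i) * C"
    by (simp only: prefactor_def C_def prod.distrib mult_ac)
  ultimately show ?thesis
    unfolding R_def det_mat_eq_det_on R_denominator_def[symmetric] M_def[symmetric]
    by (simp only: mult_ac)
qed

definition endpoints :: "nat \<Rightarrow> nat \<Rightarrow> (nat \<Rightarrow> int) \<Rightarrow> nat \<Rightarrow> point set" where
  "endpoints n m h j = (\<lambda>T. (T, h j - T)) ` abscissae n m j"

lemma finite_endpoints: "finite (endpoints n m h j)"
  by (simp add: endpoints_def finite_abscissae)

lemma endpointsD:
  assumes "e \<in> endpoints n m h j"
  shows "height e = h j" "fst e \<in> abscissae n m j"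
  using assms by (auto simp: endpoints_def height_def)

lemma sum_signed_path_sum_endpoints:
  assumes ij: "i \<in> {1..n}" "j \<in> {1..n}" and X: "\<And>s. s \<in> {1..n} \<Longrightarrow> X s \<noteq> 0"
    and h: "h j = int n - 1 \<or> w = 0 \<and> h j = int j - 1"
  shows "(\<Sum>e\<in>endpoints n m h j. signed_path_sum X w i j e) = end_coeff w n m j (start_series X i)"
proof -
  have "(\<Sum>e\<in>endpoints n m h j. signed_path_sum X w i j e) =
      (\<Sum>e\<in>endpoints n m h j. antisym_coeff (end_poly w n j) (start_series X i) (fst e))"
    using h by (intro sum.cong refl signed_path_sum_eq_end_poly[OF ij X]) (auto simp: endpointsD(1))
  also have "\<dots> = end_coeff w n m j (start_series X i)"
    unfolding endpoints_def end_coeff_def by (subst sum.reindex) (auto simp: inj_on_def)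
  finally show ?thesis .
qed

lemma
  assumes gen: "generic n X" and h: "h = (\<lambda>_. int n - 1) \<or> w = 0 \<and> h = (\<lambda>j. int j - 1)"
  shows finite_families_endpoints: "finite (families n (endpoints n m h))"
    and R_eq_sum_families: "R X w n m = (-1) ^ ((n + 1) choose 2) * prefactor X w n m *
      (\<Sum>F\<in>families n (endpoints n m h). signed_weight X w n F)"
proof -
  have E: "height e \<ge> 0" if "j \<in> {1..n}" "e \<in> endpoints n m h j" for j e
    using h that by (auto simp: endpointsD(1))
  show "finite (families n (endpoints n m h))"
    by (rule finite_families[OF finite_endpoints E])
  have "(\<Sum>F\<in>families n (endpoints n m h). signed_weight X w n F) =
      det_on {1..n} (\<lambda>i j. \<Sum>e\<in>endpoints n m h j. signed_path_sum X w i j e)"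
    by (rule sum_families[OF finite_endpoints E])
  also have "\<dots> = det_on {1..n} (\<lambda>i j. end_coeff w n m j (start_series X i))"
    using gen h by (intro det_on_cong sum_signed_path_sum_endpoints) (auto simp: generic_def)
  finally show "R X w n m = (-1) ^ ((n + 1) choose 2) * prefactor X w n m *
      (\<Sum>F\<in>families n (endpoints n m h). signed_weight X w n F)"
    by (simp only: R_eq_det_on[OF gen])
qed

subsection \<open>Splicing paths at a common vertex\<close>

text \<open>Pairing the positive with the negative terms, instead of deriving \<open>S = - S\<close>, covers
  characteristic 2.\<close>

lemma sum_sign_reversing_involution:
  fixes g :: "'b \<Rightarrow> 'a::comm_ring_1" and sg :: "'b \<Rightarrow> int"
  assumes "finite A" and closed: "\<And>x. x \<in> A \<Longrightarrow> f x \<in> A" and inv: "\<And>x. x \<in> A \<Longrightarrow> f (f x) = x"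
    and sg: "\<And>x. x \<in> A \<Longrightarrow> sg x \<in> {1, -1}" and sgf: "\<And>x. x \<in> A \<Longrightarrow> sg (f x) = - sg x"
    and g: "\<And>x. x \<in> A \<Longrightarrow> g (f x) = g x"
  shows "(\<Sum>x\<in>A. of_int (sg x) * g x) = 0"
proof -
  let ?P = "{x \<in> A. sg x = 1}" and ?N = "{x \<in> A. sg x = -1}"
  have "A = ?P \<union> ?N" "?P \<inter> ?N = {}"
    using sg by auto
  then have "(\<Sum>x\<in>A. of_int (sg x) * g x) = (\<Sum>x\<in>?P. of_int (sg x) * g x) +
      (\<Sum>x\<in>?N. of_int (sg x) * g x)"
    using assms(1) by (metis (no_types, lifting) finite_Un sum.union_disjoint)
  also have "\<dots> = (\<Sum>x\<in>?P. g x) - (\<Sum>x\<in>?N. g x)"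
    by (simp add: sum_negf)
  also have "(\<Sum>x\<in>?P. g x) = (\<Sum>x\<in>?N. g x)"
    by (rule sum.reindex_bij_witness[of _ f f]) (auto simp: closed inv sgf g)
  finally show ?thesis by simp
qed

definition splice_at :: "'v \<Rightarrow> 'v list \<Rightarrow> 'v list \<Rightarrow> 'v list" where
  "splice_at v p q = takeWhile (\<lambda>u. u \<noteq> v) p @ dropWhile (\<lambda>u. u \<noteq> v) q"

lemma splice_at_split:
  assumes "v \<notin> set a" "v \<notin> set c"
  shows "splice_at v (a @ v # b) (c @ v # d) = a @ v # d"
proof -
  have "takeWhile (\<lambda>u. u \<noteq> v) (a @ v # b) = a"
    using assms(1) by (induction a) auto
  moreover have "dropWhile (\<lambda>u. u \<noteq> v) (c @ v # d) = v # d"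
    using assms(2) by (induction c) auto
  ultimately show ?thesis by (simp add: splice_at_def)
qed

lemma splice_atE:
  assumes "v \<in> set p" "v \<in> set q"
  obtains a b c d where "v \<notin> set a" "v \<notin> set c" "p = a @ v # b" "q = c @ v # d"
    "splice_at v p q = a @ v # d" "splice_at v q p = c @ v # b"
proof -
  obtain a b where "p = a @ v # b" "v \<notin> set a" using split_list_first[OF assms(1)] by blast
  moreover obtain c d where "q = c @ v # d" "v \<notin> set c" using split_list_first[OF assms(2)] by blast
  ultimately show thesis using that[of a c b d] by (simp add: splice_at_split)
qed

lemma in_set_splice_at:
  assumes "v \<in> set p" "v \<in> set q"
  shows "v \<in> set (splice_at v p q)"
  by (rule splice_atE[OF assms]) simp

lemma set_splice_at_subset: "set (splice_at v p q) \<subseteq> set p \<union> set q"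
  by (auto simp: splice_at_def dest: set_takeWhileD set_dropWhileD)

lemma splice_at_splice_at:
  assumes "v \<in> set p" "v \<in> set q"
  shows "splice_at v (splice_at v p q) (splice_at v q p) = p"
  by (rule splice_atE[OF assms]) (simp add: splice_at_split)

lemma set_splice_at_Int_Un:
  assumes "v \<in> set p" "v \<in> set q"
    and distinct: "distinct p" "distinct q" "distinct (splice_at v p q)"
        "distinct (splice_at v q p)"
  shows "set (splice_at v p q) \<inter> set (splice_at v q p) = set p \<inter> set q"
    and "set (splice_at v p q) \<union> set (splice_at v q p) = set p \<union> set q"
proof -
  have "mset (splice_at v p q) + mset (splice_at v q p) = mset p + mset q"
    by (rule splice_atE[OF assms(1,2)]) simp
  then have "count (mset (splice_at v p q)) u + count (mset (splice_at v q p)) u =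
      count (mset p) u + count (mset q) u" for u
    by (metis count_union)
  then have bools: "of_bool (u \<in> set (splice_at v p q)) + of_bool (u \<in> set (splice_at v q p)) =
      (of_bool (u \<in> set p) + of_bool (u \<in> set q) :: nat)" for u
    using distinct by (simp add: distinct_count_atmost_1 of_bool_def)
  have "(u \<in> set (splice_at v p q) \<and> u \<in> set (splice_at v q p) \<longleftrightarrow> u \<in> set p \<and> u \<in> set q) \<and>
      (u \<in> set (splice_at v p q) \<or> u \<in> set (splice_at v q p) \<longleftrightarrow> u \<in> set p \<or> u \<in> set q)" for u
    using bools[of u] by (auto simp: of_bool_def split: if_splits)
  then show "set (splice_at v p q) \<inter> set (splice_at v q p) = set p \<inter> set q"
    "set (splice_at v p q) \<union> set (splice_at v q p) = set p \<union> set q"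
    by blast+
qed

lemma lattice_path_splice_at:
  assumes "v \<in> set p" "v \<in> set q" "lattice_path S a b p" "lattice_path S c d q"
  shows "lattice_path S a d (splice_at v p q)"
proof (rule splice_atE[OF assms(1,2)])
  fix p1 p2 q1 q2
  assume "p = p1 @ v # p2" "q = q1 @ v # q2" and splice: "splice_at v p q = p1 @ v # q2"
  then have "lattice_path S a v (p1 @ [v])" "lattice_path S v d (v # q2)"
    using assms(3,4) lattice_path_append[of S a b p1 v p2] lattice_path_append[of S c d q1 v q2]
    by simp_all
  then show ?thesis
    unfolding splice lattice_path_append[of S a d] by blast
qed

lemma segment_weight_splice_at:
  assumes "v \<in> set p" "v \<in> set q"
  shows "segment_weight X w j (splice_at v p q) * segment_weight X w j (splice_at v q p) =
    segment_weight X w j p * segment_weight X w j q"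
proof (rule splice_atE[OF assms])
  fix a b c d assume "p = a @ v # b" "q = c @ v # d" "splice_at v p q = a @ v # d"
      "splice_at v q p = c @ v # b"
  then show ?thesis
    by (simp add: segment_weight_append[of X w j a v b] segment_weight_append[of X w j a v d]
        segment_weight_append[of X w j c v b] segment_weight_append[of X w j c v d])
qed

subsection \<open>Exchanging tails in a family\<close>

lemma familiesD:
  assumes "F \<in> families n E"
  shows "perm F permutes {1..n}"
    and "k \<in> {1..n} \<Longrightarrow> perm F k \<in> {1..n}"
    and "k \<in> {1..n} \<Longrightarrow> start F k \<in> {alpha k, beta k}"
    and "k \<in> {1..n} \<Longrightarrow> endpoint F k \<in> E (perm F k)"
    and "k \<in> {1..n} \<Longrightarrow> paths F k \<in> admissible_paths k (start F k) (endpoint F k)"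
  using assms permutes_in_image[of "perm F" "{1..n}" k] by (auto simp: families_def PiE_iff)

definition meeting_pairs :: "nat \<Rightarrow> (nat \<Rightarrow> 'v set) \<Rightarrow> 'v \<Rightarrow> (nat \<times> nat) set" where
  "meeting_pairs n V v = {(i, j). i \<in> {1..n} \<and> j \<in> {1..n} \<and> i \<noteq> j \<and> v \<in> V i \<and> v \<in> V j}"

lemma meeting_pairs_nonempty_mono:
  assumes ij: "i \<in> {1..n}" "j \<in> {1..n}" "i \<noteq> j" and other: "\<And>k. k \<noteq> i \<Longrightarrow> k \<noteq> j \<Longrightarrow> V' k = V k"
    and Int: "V' i \<inter> V' j = V i \<inter> V j" and Un: "V' i \<union> V' j = V i \<union> V j"
    and "meeting_pairs n V u \<noteq> {}"
  shows "meeting_pairs n V' u \<noteq> {}"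
proof -
  obtain a b where ab: "a \<in> {1..n}" "b \<in> {1..n}" "a \<noteq> b" "u \<in> V a" "u \<in> V b"
    using assms(7) by (auto simp: meeting_pairs_def)
  consider "a \<in> {i, j}" "b \<in> {i, j}" | "a \<in> {i, j}" "b \<notin> {i, j}" | "a \<notin> {i, j}" "b \<in> {i, j}"
    | "a \<notin> {i, j}" "b \<notin> {i, j}" by blast
  then have "\<exists>a\<in>{1..n}. \<exists>b\<in>{1..n}. a \<noteq> b \<and> u \<in> V' a \<and> u \<in> V' b"
  proof cases
    case 1
    with ab have "u \<in> V' i \<inter> V' j" unfolding Int by blast
    with ij show ?thesis by blast
  next
    case 2
    with ab have "u \<in> V' i \<union> V' j" "u \<in> V' b" unfolding Un using other[of b] by blast+
    with 2 ab ij show ?thesis by blast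
  next
    case 3
    with ab have "u \<in> V' i \<union> V' j" "u \<in> V' a" unfolding Un using other[of a] by blast+
    with 3 ab ij show ?thesis by blast
  next
    case 4
    with ab show ?thesis using other[of a] other[of b] by blast
  qed
  then obtain a b where "(a, b) \<in> meeting_pairs n V' u"
    unfolding meeting_pairs_def by blast
  then show ?thesis by blast
qed

lemma family_sign_cases: "family_sign n F \<in> {1, -1}"
  by (cases "evenperm (perm F)"; cases "even (card {i \<in> {1..n}. start F i = beta i})")
    (auto simp: family_sign_def sign_def)

locale tail_exchange =
  fixes seg :: "path \<Rightarrow> point list" and splice :: "point \<Rightarrow> path \<Rightarrow> path \<Rightarrow> path"
  assumes distinct_seg: "\<pi> \<in> admissible_paths i s e \<Longrightarrow> distinct (seg \<pi>)"
    and seg_splice: "seg (splice v \<pi> \<pi>') = splice_at v (seg \<pi>) (seg \<pi>')"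
    and splice_splice: "v \<in> set (seg \<pi>) \<Longrightarrow> v \<in> set (seg \<pi>') \<Longrightarrow>
      splice v (splice v \<pi> \<pi>') (splice v \<pi>' \<pi>) = \<pi>"
    and splice_admissible: "i \<ge> 1 \<Longrightarrow> i' \<ge> 1 \<Longrightarrow> s \<in> {alpha i, beta i} \<Longrightarrow> s' \<in> {alpha i', beta i'} \<Longrightarrow>
      \<pi> \<in> admissible_paths i s e \<Longrightarrow> \<pi>' \<in> admissible_paths i' s' e' \<Longrightarrow>
      v \<in> set (seg \<pi>) \<Longrightarrow> v \<in> set (seg \<pi>') \<Longrightarrow> splice v \<pi> \<pi>' \<in> admissible_paths i s e'"
begin

abbreviation track :: "family \<Rightarrow> nat \<Rightarrow> point set" where
  "track F k \<equiv> set (seg (paths F k))"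

definition meeting :: "nat \<Rightarrow> family \<Rightarrow> bool" where
  "meeting n F \<longleftrightarrow> (\<exists>v. meeting_pairs n (track F) v \<noteq> {})"

definition swap_tails_at :: "point \<Rightarrow> nat \<Rightarrow> nat \<Rightarrow> family \<Rightarrow> family" where
  "swap_tails_at v i j F = F\<lparr>perm := perm F \<circ> transpose i j, endpoint := endpoint F \<circ> transpose i j,
    paths := (paths F)
      (i := splice v (paths F i) (paths F j), j := splice v (paths F j) (paths F i))\<rparr>"

text \<open>The vertex depends only on the set of meeting points and the two indices only on the paths
  through that vertex; the exchange preserves both, hence it is an involution.\<close>

definition swap_tails :: "nat \<Rightarrow> family \<Rightarrow> family" where
  "swap_tails n F =
    (let v = (SOME v. meeting_pairs n (track F) v \<noteq> {});
         (i, j) = (SOME ij. ij \<in> meeting_pairs n (track F) v)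
     in swap_tails_at v i j F)"

context
  fixes n E F v i j
  assumes F: "F \<in> families n E" and meet: "(i, j) \<in> meeting_pairs n (track F) v"
begin

lemma meeting_pairD: "i \<in> {1..n}" "j \<in> {1..n}" "i \<noteq> j" "v \<in> track F i" "v \<in> track F j"
  using meet by (auto simp: meeting_pairs_def)

lemma splice_paths_admissible:
  "splice v (paths F i) (paths F j) \<in> admissible_paths i (start F i) (endpoint F j)"
  "splice v (paths F j) (paths F i) \<in> admissible_paths j (start F j) (endpoint F i)"
  using meeting_pairD familiesD(3,5)[OF F]
  by (auto intro!: splice_admissible[of i j "start F i" "start F j"]
    splice_admissible[of j i "start F j" "start F i"])

lemma swap_tails_at_in_families: "swap_tails_at v i j F \<in> families n E"
proof -
  have perm: "transpose i j permutes {1..n}"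
    using meeting_pairD by (intro permutes_swap_id)
  have image: "transpose i j k \<in> {1..n} \<longleftrightarrow> k \<in> {1..n}" for k
    by (rule permutes_in_image[OF perm])
  have "perm F \<circ> transpose i j permutes {1..n}"
    using perm familiesD(1)[OF F] by (rule permutes_compose)
  moreover have "endpoint F \<circ> transpose i j \<in> (\<Pi>\<^sub>E k\<in>{1..n}. E ((perm F \<circ> transpose i j) k))"
  proof (rule PiE_I)
    fix k assume "k \<in> {1..n}"
    then show "(endpoint F \<circ> transpose i j) k \<in> E ((perm F \<circ> transpose i j) k)"
      using familiesD(4)[OF F] image by simp
  next
    fix k assume "k \<notin> {1..n}"
    then have "transpose i j k \<notin> {1..n}" using image by blast
    then show "(endpoint F \<circ> transpose i j) k = undefined"
      using F by (simp add: families_def PiE_iff extensional_def)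
  qed
  moreover have "paths (swap_tails_at v i j F) \<in>
      (\<Pi>\<^sub>E k\<in>{1..n}. admissible_paths k (start F k) ((endpoint F \<circ> transpose i j) k))"
    using F meeting_pairD splice_paths_admissible familiesD(5)[OF F]
    by (auto simp: swap_tails_at_def PiE_iff families_def extensional_def transpose_def)
  ultimately show ?thesis
    using F by (simp add: families_def swap_tails_at_def)
qed

lemma swap_tails_at_swap_tails_at: "swap_tails_at v i j (swap_tails_at v i j F) = F"
  using meeting_pairD by (simp add: swap_tails_at_def splice_splice comp_assoc)

lemma family_sign_swap_tails_at: "family_sign n (swap_tails_at v i j F) = - family_sign n F"
proof -
  have "permutation (perm F)"
    using familiesD(1)[OF F] by (rule permutes_imp_permutation[rotated]) simp
  then show ?thesis
    using meeting_pairD(3)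
    by (simp add: family_sign_def swap_tails_at_def sign_compose permutation_swap_id sign_swap_id)
qed

lemma track_swap_tails_at:
  "k \<noteq> i \<Longrightarrow> k \<noteq> j \<Longrightarrow> track (swap_tails_at v i j F) k = track F k"
  "track (swap_tails_at v i j F) i \<inter> track (swap_tails_at v i j F) j = track F i \<inter> track F j"
  "track (swap_tails_at v i j F) i \<union> track (swap_tails_at v i j F) j = track F i \<union> track F j"
  "v \<in> track (swap_tails_at v i j F) k \<longleftrightarrow> v \<in> track F k"
proof -
  have distinct: "distinct (seg (paths F k))" if "k \<in> {1..n}" for k
    using familiesD(5)[OF F that] by (rule distinct_seg)
  have distinct_splice: "distinct (splice_at v (seg (paths F i)) (seg (paths F j)))"
    "distinct (splice_at v (seg (paths F j)) (seg (paths F i)))"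
    using splice_paths_admissible[THEN distinct_seg] by (simp_all add: seg_splice)
  show "track (swap_tails_at v i j F) i \<inter> track (swap_tails_at v i j F) j = track F i \<inter> track F j"
    "track (swap_tails_at v i j F) i \<union> track (swap_tails_at v i j F) j = track F i \<union> track F j"
    using meeting_pairD
      set_splice_at_Int_Un[OF meeting_pairD(4,5) distinct distinct distinct_splice]
    by (simp_all add: swap_tails_at_def seg_splice)
  show "v \<in> track (swap_tails_at v i j F) k \<longleftrightarrow> v \<in> track F k"
    using meeting_pairD by (auto simp: swap_tails_at_def seg_splice in_set_splice_at)
qed (simp add: swap_tails_at_def)

lemma meeting_pairs_swap_tails_at:
  "meeting_pairs n (track (swap_tails_at v i j F)) u \<noteq> {} \<longleftrightarrow> meeting_pairs n (track F) u \<noteq> {}"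
  "meeting_pairs n (track (swap_tails_at v i j F)) v = meeting_pairs n (track F) v"
proof
  note track = track_swap_tails_at(1-3) and ij = meeting_pairD(1-3)
  show "meeting_pairs n (track (swap_tails_at v i j F)) u \<noteq> {}"
    if "meeting_pairs n (track F) u \<noteq> {}"
    by (rule meeting_pairs_nonempty_mono[OF ij track that])
  show "meeting_pairs n (track F) u \<noteq> {}"
    if "meeting_pairs n (track (swap_tails_at v i j F)) u \<noteq> {}"
    by (rule meeting_pairs_nonempty_mono[OF ij track[symmetric] that])
  show "meeting_pairs n (track (swap_tails_at v i j F)) v = meeting_pairs n (track F) v"
    by (simp add: meeting_pairs_def track_swap_tails_at(4))
qed

lemma family_weight_swap_tails_at:
  assumes "path_weight X w (perm F j) (splice v (paths F i) (paths F j)) *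
      path_weight X w (perm F i) (splice v (paths F j) (paths F i)) =
    path_weight X w (perm F i) (paths F i) * path_weight X w (perm F j) (paths F j)"
  shows "family_weight X w n (swap_tails_at v i j F) = family_weight X w n F"
proof -
  have split: "prod f {1..n} = f i * f j * prod f ({1..n} - {i} - {j})"
      for f :: "nat \<Rightarrow> 'b::comm_monoid_mult"
    using prod.remove[of "{1..n}" i f] prod.remove[of "{1..n} - {i}" j f] meeting_pairD
    by (simp add: mult.assoc)
  let ?F = "swap_tails_at v i j F"
  have "path_weight X w (perm ?F i) (paths ?F i) * path_weight X w (perm ?F j) (paths ?F j) =
      path_weight X w (perm F i) (paths F i) * path_weight X w (perm F j) (paths F j)"
    using meeting_pairD(3) assms by (simp add: swap_tails_at_def)
  moreover have "(\<Prod>k\<in>{1..n} - {i} - {j}. path_weight X w (perm ?F k) (paths ?F k)) =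
      (\<Prod>k\<in>{1..n} - {i} - {j}. path_weight X w (perm F k) (paths F k))"
    by (intro prod.cong) (auto simp: swap_tails_at_def)
  ultimately show ?thesis
    unfolding family_weight_def split by simp
qed

end

lemma swap_tails_eq:
  assumes F: "F \<in> families n E" and "meeting n F"
  obtains v i j where "(i, j) \<in> meeting_pairs n (track F) v"
    "swap_tails n F = swap_tails_at v i j F"
    "swap_tails n (swap_tails n F) = F"
proof -
  define v where "v = (SOME v. meeting_pairs n (track F) v \<noteq> {})"
  obtain i j where ij: "(i, j) = (SOME ij. ij \<in> meeting_pairs n (track F) v)"
    by (metis surj_pair)
  have "meeting_pairs n (track F) v \<noteq> {}"
    using assms(2) unfolding meeting_def v_def by (rule someI_ex)
  then have meet: "(i, j) \<in> meeting_pairs n (track F) v"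
    unfolding ij by (rule some_in_eq[THEN iffD2])
  have swap: "swap_tails n F = swap_tails_at v i j F"
    by (simp add: swap_tails_def flip: v_def ij)
  have "swap_tails n (swap_tails n F) = swap_tails_at v i j (swap_tails_at v i j F)"
    unfolding swap
    by (simp add: swap_tails_def meeting_pairs_swap_tails_at[OF F meet] flip: v_def ij)
  then have "swap_tails n (swap_tails n F) = F"
    by (simp only: swap_tails_at_swap_tails_at[OF F meet])
  with meet swap show thesis by (rule that)
qed

lemma sum_meeting_families_eq_0:
  assumes fin: "finite (families n E)"
    and invariant: "\<And>F v i j. F \<in> families n E \<Longrightarrow> (i, j) \<in> meeting_pairs n (track F) v \<Longrightarrow> Q F \<Longrightarrow>
      Q (swap_tails_at v i j F)"
    and weight: "\<And>F v i j. F \<in> families n E \<Longrightarrow> (i, j) \<in> meeting_pairs n (track F) v \<Longrightarrow>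
      family_weight X w n (swap_tails_at v i j F) = family_weight X w n F"
  shows "(\<Sum>F | F \<in> families n E \<and> Q F \<and> meeting n F. signed_weight X w n F) = 0"
proof (rule sum_sign_reversing_involution[where f = "swap_tails n"])
  fix F assume "F \<in> {F. F \<in> families n E \<and> Q F \<and> meeting n F}"
  then have F: "F \<in> families n E" "Q F" "meeting n F" by auto
  then obtain v i j where meet: "(i, j) \<in> meeting_pairs n (track F) v"
    and swap: "swap_tails n F = swap_tails_at v i j F"
    and twice: "swap_tails n (swap_tails n F) = F"
    using swap_tails_eq by metis
  note at = swap_tails_at_in_families[OF F(1) meet] meeting_pairs_swap_tails_at[OF F(1) meet]
  show "swap_tails n F \<in> {F. F \<in> families n E \<and> Q F \<and> meeting n F}"
    using F at invariant[OF F(1) meet F(2)] by (simp add: swap meeting_def)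
  show "swap_tails n (swap_tails n F) = F"
    by (fact twice)
  show "family_sign n (swap_tails n F) = - family_sign n F"
    by (simp add: swap family_sign_swap_tails_at[OF F(1) meet])
  show "family_weight X w n (swap_tails n F) = family_weight X w n F"
    by (simp add: swap weight[OF F(1) meet])
qed (use fin family_sign_cases in auto)

end

subsection \<open>Cancellation of intersecting families\<close>

lemma initial_path_side:
  assumes "i \<ge> 1" "s \<in> {alpha i, beta i}" "\<pi> \<in> admissible_paths i s e" "u \<in> set (fst \<pi>)"
  shows "2 * int i \<le> side i s * (fst u - snd u)"
proof -
  have "side i s * (fst s - snd s) \<le> side i s * (fst u - snd u)"
    using side_cases[of i s] initial_steps_side[OF assms(1,2)]
    by (intro lattice_path_mono(1)[OF admissible_pathsD(1)[OF assms(3)] _ assms(4)]) auto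
  moreover have "side i s * (fst s - snd s) = 2 * int i"
    using side_cases[of i s] by (subst (1 2) start_coordinates[OF assms(2)]) auto
  ultimately show ?thesis by simp
qed

lemma distinct_initial_segment:
  assumes "\<pi> \<in> admissible_paths i s e"
  shows "distinct (fst \<pi>)"
proof -
  note path = admissible_pathsD(1)[OF assms]
  show ?thesis
  proof (cases "s = alpha i")
    case True
    then show ?thesis
      by (intro lattice_path_distinct[OF path, of snd]) (auto simp: initial_steps_def)
  next
    case False
    then show ?thesis
      by (intro lattice_path_distinct[OF path, of fst]) (auto simp: initial_steps_def)
  qed
qed

lemma distinct_final_segment:
  assumes "\<pi> \<in> admissible_paths i s e"
  shows "distinct (snd \<pi>)"
  by (rule lattice_path_distinct[OF admissible_pathsD(4)[OF assms], of height])
    (auto simp: height_def)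

definition splice_initial :: "point \<Rightarrow> path \<Rightarrow> path \<Rightarrow> path" where
  "splice_initial v \<pi> \<pi>' = (splice_at v (fst \<pi>) (fst \<pi>'), snd \<pi>')"

definition splice_final :: "point \<Rightarrow> path \<Rightarrow> path \<Rightarrow> path" where
  "splice_final v \<pi> \<pi>' = (fst \<pi>, splice_at v (snd \<pi>) (snd \<pi>'))"

interpretation initial: tail_exchange fst splice_initial
proof
  fix i i' s s' \<pi> \<pi>' e e' v
  assume i: "1 \<le> i" "s \<in> {alpha i, beta i}" "\<pi> \<in> admissible_paths i s e"
    and i': "1 \<le> i'" "s' \<in> {alpha i', beta i'}" "\<pi>' \<in> admissible_paths i' s' e'"
    and v: "v \<in> set (fst \<pi>)" "v \<in> set (fst \<pi>')"
  note D = admissible_pathsD[OF i(3)] and D' = admissible_pathsD[OF i'(3)]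
  have "side i s = side i' s'"
    using initial_path_side[OF i v(1)] initial_path_side[OF i' v(2)] side_cases[of i s]
      side_cases[of i' s'] i(1) i'(1)
    by auto
  then have "initial_steps i s = initial_steps i' s'"
    using initial_steps_side[OF i(1,2)] initial_steps_side[OF i'(1,2)] by simp
  then have "lattice_path (initial_steps i s) s (last (fst \<pi>')) (splice_at v (fst \<pi>) (fst \<pi>'))"
    using lattice_path_splice_at[OF v D(1)] D'(1) by simp
  moreover have "\<forall>u\<in>set (splice_at v (fst \<pi>) (fst \<pi>')). height u \<le> 0"
    using D(3) D'(3) set_splice_at_subset[of v "fst \<pi>" "fst \<pi>'"] by blast
  ultimately show "splice_initial v \<pi> \<pi>' \<in> admissible_paths i s e'"
    unfolding splice_initial_def using D'(2,4) by (intro admissible_pathsI)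
qed (auto simp: splice_initial_def splice_at_splice_at distinct_initial_segment)

interpretation final: tail_exchange snd splice_final
proof
  fix i i' s s' \<pi> \<pi>' e e' v
  assume \<pi>: "\<pi> \<in> admissible_paths i s e" "\<pi>' \<in> admissible_paths i' s' e'"
    and v: "v \<in> set (snd \<pi>)" "v \<in> set (snd \<pi>')"
  note D = admissible_pathsD[OF \<pi>(1)] and D' = admissible_pathsD[OF \<pi>(2)]
  show "splice_final v \<pi> \<pi>' \<in> admissible_paths i s e'"
    unfolding splice_final_def
    using D(1-3) lattice_path_splice_at[OF v D(4) D'(4)] by (intro admissible_pathsI)
qed (auto simp: splice_final_def splice_at_splice_at distinct_final_segment)

lemma path_weight_admissible:
  assumes "\<pi> \<in> admissible_paths i s e"
  shows "path_weight X w j \<pi> = segment_weight X w 0 (fst \<pi>) * segment_weight X w j (snd \<pi>)"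
proof -
  have "segment_weight X w j (fst \<pi>) = segment_weight X w 0 (fst \<pi>)"
    using admissible_pathsD(1)[OF assms]
    by (rule segment_weight_cong) (auto simp: step_weight_def initial_steps_def split: if_splits)
  then show ?thesis by (simp add: path_weight_def)
qed

lemma family_weight_swap_initial_tails:
  assumes F: "F \<in> families n E" and meet: "(i, j) \<in> meeting_pairs n (initial.track F) v"
  shows "family_weight X w n (initial.swap_tails_at v i j F) = family_weight X w n F"
proof (rule initial.family_weight_swap_tails_at[OF F meet])
  note ij = initial.meeting_pairD[OF F meet]
  note weights = initial.splice_paths_admissible[OF F meet, THEN path_weight_admissible,
      unfolded splice_initial_def fst_conv snd_conv]
    familiesD(5)[OF F ij(1), THEN path_weight_admissible]
    familiesD(5)[OF F ij(2), THEN path_weight_admissible]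
  show "path_weight X w (perm F j) (splice_initial v (paths F i) (paths F j)) *
      path_weight X w (perm F i) (splice_initial v (paths F j) (paths F i)) =
    path_weight X w (perm F i) (paths F i) * path_weight X w (perm F j) (paths F j)"
    using segment_weight_splice_at[OF ij(4,5), of X w 0]
    unfolding splice_initial_def weights by (simp add: ac_simps)
qed

lemma initially_disjoint_families_iff:
  "F \<in> initially_disjoint_families n E \<longleftrightarrow> F \<in> families n E \<and> \<not> initial.meeting n F"
  unfolding initially_disjoint_families_def initial_vertices_def initial.meeting_def
    meeting_pairs_def by blast

lemma sum_initially_disjoint_families:
  assumes "finite (families n E)"
  shows "(\<Sum>F\<in>initially_disjoint_families n E. signed_weight X w n F) =
      (\<Sum>F\<in>families n E. signed_weight X w n F)"
proof -
  have "(\<Sum>F | F \<in> families n E \<and> True \<and> initial.meeting n F. signed_weight X w n F) = 0"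
    using family_weight_swap_initial_tails
    by (intro initial.sum_meeting_families_eq_0[OF assms]) auto
  moreover have "families n E - initially_disjoint_families n E =
      {F. F \<in> families n E \<and> True \<and> initial.meeting n F}"
    by (auto simp: initially_disjoint_families_iff)
  ultimately show ?thesis
    using sum.subset_diff[OF _ assms, of "initially_disjoint_families n E" "signed_weight X w n"]
    by (simp add: initially_disjoint_families_iff subset_iff)
qed

lemma R_eq_sum_initially_disjoint_families:
  assumes "generic n X" "h = (\<lambda>_. int n - 1) \<or> w = 0 \<and> h = (\<lambda>j. int j - 1)"
  shows "R X w n m = (-1) ^ ((n + 1) choose 2) * prefactor X w n m *
      (\<Sum>F\<in>initially_disjoint_families n (endpoints n m h). signed_weight X w n F)"
  unfolding sum_initially_disjoint_families[OF finite_families_endpoints[OF assms]]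
  by (rule R_eq_sum_families[OF assms])

lemma initial_vertex_on_final_segment:
  assumes \<pi>: "\<pi> \<in> admissible_paths i s e" and \<pi>': "\<pi>' \<in> admissible_paths i' s' e'"
    and u: "u \<in> set (fst \<pi>)" "u \<in> set (snd \<pi>')"
  shows "u \<in> set (fst \<pi>')"
proof -
  note D = admissible_pathsD[OF \<pi>']
    and mono = lattice_path_mono(1)[OF admissible_pathsD(4)[OF \<pi>'] _ u(2)]
  let ?P = "last (fst \<pi>')"
  have "fst ?P \<le> fst u" by (rule mono) auto
  moreover have "snd ?P \<le> snd u" by (rule mono) auto
  moreover have "height u \<le> height ?P" using admissible_pathsD(3)[OF \<pi>] u(1) D(2) by simp
  ultimately have "u = ?P" by (simp add: height_def prod_eq_iff)
  then show ?thesis using lattice_path_ends(4)[OF D(1)] by simp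
qed

lemma disjoint_families_iff:
  "F \<in> disjoint_families n E \<longleftrightarrow> F \<in> initially_disjoint_families n E \<and> \<not> final.meeting n F"
proof
  assume "F \<in> disjoint_families n E"
  then show "F \<in> initially_disjoint_families n E \<and> \<not> final.meeting n F"
    unfolding disjoint_families_def initially_disjoint_families_def vertices_def
      initial_vertices_def
      final.meeting_def meeting_pairs_def by blast
next
  assume F: "F \<in> initially_disjoint_families n E \<and> \<not> final.meeting n F"
  then have fam: "F \<in> families n E" by (simp add: initially_disjoint_families_iff)
  have "vertices (paths F i) \<inter> vertices (paths F j) = {}"
    if ij: "i \<in> {1..n}" "j \<in> {1..n}" "i \<noteq> j" for i j
  proof -
    have "set (fst (paths F i)) \<inter> set (fst (paths F j)) = {}"
      using F ij unfolding initially_disjoint_families_def initial_vertices_def by blast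
    moreover have "set (snd (paths F i)) \<inter> set (snd (paths F j)) = {}"
      using F ij unfolding final.meeting_def meeting_pairs_def by blast
    moreover note familiesD(5)[OF fam ij(1)] familiesD(5)[OF fam ij(2)]
    ultimately show ?thesis
      unfolding vertices_def using initial_vertex_on_final_segment by blast
  qed
  with fam show "F \<in> disjoint_families n E"
    unfolding disjoint_families_def by blast
qed

lemma disjoint_familiesD:
  assumes "F \<in> disjoint_families n E"
  shows "F \<in> families n E"
    and "i \<in> {1..n} \<Longrightarrow> j \<in> {1..n} \<Longrightarrow> i \<noteq> j \<Longrightarrow> set (fst (paths F i)) \<inter> set (fst (paths F j)) = {}"
    and "i \<in> {1..n} \<Longrightarrow> j \<in> {1..n} \<Longrightarrow> i \<noteq> j \<Longrightarrow> set (snd (paths F i)) \<inter> set (snd (paths F j)) = {}"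
  using assms unfolding disjoint_families_def vertices_def by blast+

lemma sum_disjoint_families:
  assumes fin: "finite (families n E)"
    and one: "\<And>F k. F \<in> families n E \<Longrightarrow> k \<in> {1..n} \<Longrightarrow>
        segment_weight X w (perm F k) (snd (paths F k)) = 1"
  shows "(\<Sum>F\<in>disjoint_families n E. signed_weight X w n F) =
    (\<Sum>F\<in>initially_disjoint_families n E. signed_weight X w n F)"
proof -
  let ?I = "initially_disjoint_families n E"
  have fst_swap: "fst (paths (final.swap_tails_at v i j F) k) = fst (paths F k)" for F v i j k
    by (simp add: final.swap_tails_at_def splice_final_def)
  have weight: "family_weight X w n F = (\<Prod>k=1..n. segment_weight X w 0 (fst (paths F k)))"
    if "F \<in> families n E" for F
    unfolding family_weight_def
  proof (rule prod.cong[OF refl])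
    fix k assume k: "k \<in> {1..n}"
    show "path_weight X w (perm F k) (paths F k) = segment_weight X w 0 (fst (paths F k))"
      by (simp add: path_weight_admissible[OF familiesD(5)[OF that k]] one[OF that k])
  qed
  have "(\<Sum>F | F \<in> families n E \<and> \<not> initial.meeting n F \<and> final.meeting n F.
      signed_weight X w n F) = 0"
  proof (rule final.sum_meeting_families_eq_0[OF fin])
    fix F v i j assume F: "F \<in> families n E" and meet: "(i, j) \<in> meeting_pairs n (final.track F) v"
    show "\<not> initial.meeting n (final.swap_tails_at v i j F)" if "\<not> initial.meeting n F"
      using that by (simp add: initial.meeting_def fst_swap)
    show "family_weight X w n (final.swap_tails_at v i j F) = family_weight X w n F"
      by (simp add: weight F final.swap_tails_at_in_families[OF F meet] fst_swap)
  qed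
  moreover have "?I - disjoint_families n E =
      {F. F \<in> families n E \<and> \<not> initial.meeting n F \<and> final.meeting n F}"
    by (auto simp: disjoint_families_iff initially_disjoint_families_iff)
  moreover have "finite ?I" "disjoint_families n E \<subseteq> ?I"
    using fin
    by (auto simp: disjoint_families_iff initially_disjoint_families_iff
      elim: finite_subset[rotated])
  ultimately show ?thesis
    using sum.subset_diff[of "disjoint_families n E" ?I "signed_weight X w n"] by simp
qed

lemma segment_weight_final_eq_1:
  assumes path: "lattice_path {(1, 0), (0, 1)} a b p" and w: "w = 1 \<or> height b \<le> int j - 1"
  shows "segment_weight X w j p = 1"
proof (rule segment_weight_eq_1[OF path])
  fix u v assume uv: "u \<in> set p" "v \<in> set p" "v - u \<in> {(1, 0), (0, 1)}"
  then have "height v = height u + 1"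
    by (auto simp: height_def prod_eq_iff)
  moreover have "height v \<le> height b"
    by (rule lattice_path_mono(2)[OF path _ uv(2)]) (auto simp: height_def)
  ultimately show "step_weight X w j u v = 1"
    using w uv(3) by (auto simp: step_weight_def)
qed

subsection \<open>The order of disjoint paths\<close>

lemma lattice_path_nth_time:
  fixes time :: "point \<Rightarrow> int"
  assumes path: "lattice_path S a b p" and time: "\<And>u s. s \<in> S \<Longrightarrow> time (u + s) = time u + 1"
  shows "k < length p \<Longrightarrow> time (p ! k) = time a + int k"
proof (induction k)
  case 0
  then show ?case using lattice_path_ends(1)[OF path] by (simp add: hd_conv_nth)
next
  case (Suc k)
  then have "p ! Suc k - p ! k \<in> S"
    using path by (simp add: lattice_path_def successively_conv_nth)
  with Suc time[of "p ! Suc k - p ! k" "p ! k"] show ?case by simp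
qed

lemma lattice_path_reaches_time:
  fixes time :: "point \<Rightarrow> int"
  assumes path: "lattice_path S a b p" and time: "\<And>u s. s \<in> S \<Longrightarrow> time (u + s) = time u + 1"
    and T: "time a \<le> T" "T \<le> time b"
  obtains u where "u \<in> set p" "time u = T"
proof -
  have "p \<noteq> []" "b = p ! (length p - 1)"
    using path by (auto simp: lattice_path_def last_conv_nth)
  then have "nat (T - time a) < length p"
    using lattice_path_nth_time[OF path time, of "length p - 1"] T
    by (auto simp: of_nat_diff Suc_le_eq)
  with T show thesis
    using lattice_path_nth_time[OF path time] by (intro that[of "p ! nat (T - time a)"]) auto
qed

text \<open>A discrete intermediate value theorem: the difference of the positions of the two paths
  changes by at most 1 per unit of time.\<close>

lemma lattice_paths_meet:
  fixes time pos :: "point \<Rightarrow> int"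
  assumes path: "lattice_path S a b p" and path': "lattice_path S a' b' p'"
    and time: "\<And>u s. s \<in> S \<Longrightarrow> time (u + s) = time u + 1"
    and pos: "\<And>u s. s \<in> S \<Longrightarrow> pos (u + s) \<in> {pos u, pos u + 1}"
    and inj: "\<And>u v. u \<in> set p \<Longrightarrow> v \<in> set p' \<Longrightarrow> time u = time v \<Longrightarrow> pos u = pos v \<Longrightarrow> u = v"
    and c: "c \<in> set p" "c' \<in> set p'" "time c = time c'" "pos c \<le> pos c'"
    and d: "d \<in> set p" "d' \<in> set p'" "time d = time d'" "pos d' \<le> pos d"
    and "time c \<le> time d"
  shows "set p \<inter> set p' \<noteq> {}"
proof -
  obtain k k' m m' where nth: "k < length p" "c = p ! k" "k' < length p'" "c' = p' ! k'"
      "m < length p" "d = p ! m" "m' < length p'" "d' = p' ! m'"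
    using c(1,2) d(1,2) by (metis in_set_conv_nth)
  note t = lattice_path_nth_time[OF path time] and t' = lattice_path_nth_time[OF path' time]
  have km: "time a + int k = time a' + int k'" "time a + int m = time a' + int m'" "k \<le> m"
    using c(3) d(3) \<open>time c \<le> time d\<close> nth t t' by auto
  define f where "f r = pos (p ! (k + r)) - pos (p' ! (k' + r))" for r
  have step: "pos (q ! Suc r) \<in> {pos (q ! r), pos (q ! r) + 1}"
    if "lattice_path S a b q" "Suc r < length q" for q a b r
    using that pos[of "q ! Suc r - q ! r" "q ! r"]
    by (auto simp: lattice_path_def successively_conv_nth)
  have "\<bar>f (r + 1) - f r\<bar> \<le> 1" if "r < m - k" for r
  proof -
    have "Suc (k + r) < length p" "Suc (k' + r) < length p'" using that nth km by linarith+
    then show ?thesis using step[OF path, of "k + r"] step[OF path', of "k' + r"]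
      by (auto simp: f_def)
  qed
  moreover have "f 0 \<le> 0" "0 \<le> f (m - k)"
  proof -
    have "k + (m - k) = m" "k' + (m - k) = m'" using km by linarith+
    then show "f 0 \<le> 0" "0 \<le> f (m - k)" using c(4) d(4) nth by (simp_all add: f_def)
  qed
  ultimately obtain r where r: "r \<le> m - k" "f r = 0"
    using nat0_intermed_int_val[of "m - k" f 0] by blast
  have len: "k + r < length p" "k' + r < length p'" using r km nth by linarith+
  then have "p ! (k + r) = p' ! (k' + r)"
    using r(2) km(1) t t' by (intro inj) (auto simp: f_def)
  then show ?thesis
    using len nth_mem[of "k + r" p] nth_mem[of "k' + r" p'] by auto
qed

lemma final_paths_ordered:
  assumes path: "lattice_path {(1, 0), (0, 1)} a b p"
    and path': "lattice_path {(1, 0), (0, 1)} a' b' p'"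
    and "set p \<inter> set p' = {}" and h: "height a = height a'" "height b \<le> height b'"
    and "fst a < fst a'"
  shows "fst b < fst b'"
proof (rule ccontr)
  assume "\<not> fst b < fst b'"
  have steps: "height (u + s) = height u + 1" "fst (u + s) \<in> {fst u, fst u + 1}"
    if "s \<in> {(1, 0), (0, 1)}" for u s
    using that by (auto simp: height_def)
  note ends = lattice_path_ends[OF path] lattice_path_ends[OF path']
  have "height a \<le> height b"
    by (rule lattice_path_mono[OF path _ ends(4)]) (auto simp: height_def)
  then obtain d' where d': "d' \<in> set p'" "height d' = height b"
    using lattice_path_reaches_time[OF path' steps(1), of "height b"] h by auto
  have "fst d' \<le> fst b'"
    by (rule lattice_path_mono(2)[OF path' _ d'(1)]) auto
  then have "set p \<inter> set p' \<noteq> {}"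
    using \<open>\<not> fst b < fst b'\<close> \<open>fst a < fst a'\<close> \<open>height a \<le> height b\<close> h d' ends
    by (intro lattice_paths_meet[OF path path' steps,
          where c = a and c' = a' and d = b and d' = d'])
      (auto simp: height_def prod_eq_iff)
  with \<open>set p \<inter> set p' = {}\<close> show False by blast
qed

text \<open>The coordinate that every step of an initial segment increases by 1.\<close>

definition clock :: "int \<Rightarrow> point \<Rightarrow> int" where
  "clock \<epsilon> u = (if \<epsilon> = 1 then fst u else snd u)"

lemma initial_step:
  assumes "\<epsilon> \<in> {1, -1}" "s \<in> {(1, 1), (\<epsilon>, - \<epsilon>)}"
  shows "clock \<epsilon> (u + s) = clock \<epsilon> u + 1" and "height (u + s) \<in> {height u, height u + 2}"
  using assms by (auto simp: clock_def height_def)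

lemma even_height_initial_path:
  assumes "\<epsilon> \<in> {1, -1}" and path: "lattice_path {(1, 1), (\<epsilon>, - \<epsilon>)} a b p"
    and "height b = 0" "u \<in> set p"
  shows "even (height u)"
proof -
  have "height u mod 2 \<le> height b mod 2"
  proof (rule lattice_path_mono(2)[OF path _ assms(4)])
    show "height u mod 2 \<le> height (u + s) mod 2" if "s \<in> {(1, 1), (\<epsilon>, - \<epsilon>)}" for u s
      using initial_step(2)[OF assms(1) that, of u] by auto
  qed
  with assms(3) have "height u mod 2 \<le> 0" by simp
  then show ?thesis by presburger
qed

lemma height_initial_path_le:
  assumes "\<epsilon> \<in> {1, -1}" and path: "lattice_path {(1, 1), (\<epsilon>, - \<epsilon>)} a b p" and "u \<in> set p"
  shows "height u \<le> height a + 2 * (clock \<epsilon> u - clock \<epsilon> a)"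
proof -
  have "2 * clock \<epsilon> a - height a \<le> 2 * clock \<epsilon> u - height u"
  proof (rule lattice_path_mono(1)[OF path _ assms(3)])
    show "2 * clock \<epsilon> u - height u \<le> 2 * clock \<epsilon> (u + s) - height (u + s)"
      if "s \<in> {(1, 1), (\<epsilon>, - \<epsilon>)}" for u s
      using initial_step[OF assms(1) that, of u] by auto
  qed
  then show ?thesis by simp
qed

lemma initial_paths_ordered:
  assumes eps: "\<epsilon> \<in> {1, -1}" and path: "lattice_path {(1, 1), (\<epsilon>, - \<epsilon>)} a b p"
    and path': "lattice_path {(1, 1), (\<epsilon>, - \<epsilon>)} a' b' p'"
    and disjoint: "set p \<inter> set p' = {}" and p: "\<forall>u\<in>set p. height u \<le> 0"
    and h: "height b = 0" "height b' = 0"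
    and t: "clock \<epsilon> a' \<le> clock \<epsilon> a" "clock \<epsilon> a \<le> clock \<epsilon> b'"
    and below: "height a' + 2 * (clock \<epsilon> a - clock \<epsilon> a') \<le> height a"
  shows "clock \<epsilon> b < clock \<epsilon> b'"
proof (rule ccontr)
  assume "\<not> clock \<epsilon> b < clock \<epsilon> b'"
  define pos where "pos u = height u div 2" for u
  note clock = initial_step(1)[OF eps]
  have pos: "pos (u + s) \<in> {pos u, pos u + 1}" if "s \<in> {(1, 1), (\<epsilon>, - \<epsilon>)}" for u s
    using initial_step(2)[OF eps that, of u] by (auto simp: pos_def)
  obtain c' where c': "c' \<in> set p'" "clock \<epsilon> c' = clock \<epsilon> a"
    using lattice_path_reaches_time[OF path' clock t] by blast
  obtain d where d: "d \<in> set p" "clock \<epsilon> d = clock \<epsilon> b'"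
    using lattice_path_reaches_time[OF path clock t(2)] \<open>\<not> clock \<epsilon> b < clock \<epsilon> b'\<close> by auto
  have "height c' \<le> height a"
    using height_initial_path_le[OF eps path' c'(1)] below c'(2) by simp
  then have "pos c' \<le> pos a"
    by (simp add: pos_def zdiv_mono1)
  moreover have "pos d \<le> pos b'"
  proof -
    have "height d \<le> 0" using p d(1) by blast
    then show ?thesis unfolding pos_def h(2) by presburger
  qed
  moreover have "u = v" if "u \<in> set p'" "v \<in> set p" "clock \<epsilon> u = clock \<epsilon> v" "pos u = pos v" for u v
  proof -
    have "even (height u)" "even (height v)"
      using even_height_initial_path[OF eps path' h(2) that(1)]
        even_height_initial_path[OF eps path h(1) that(2)] .
    with that(4) have "height u = height v"
      by (auto simp: pos_def elim!: evenE)
    with that(3) show ?thesis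
      by (auto simp: clock_def height_def prod_eq_iff split: if_splits)
  qed
  ultimately have "set p' \<inter> set p \<noteq> {}"
    using c' d t(2) lattice_path_ends[OF path] lattice_path_ends[OF path']
    by (intro lattice_paths_meet[OF path' path clock pos,
          where c = c' and c' = a and d = b' and d' = d]) auto
  with disjoint show False by blast
qed

definition crossing :: "family \<Rightarrow> nat \<Rightarrow> point" where
  "crossing F k = last (fst (paths F k))"

lemma crossing_coordinates:
  assumes F: "F \<in> families n E" and k: "k \<in> {1..n}"
  shows "snd (crossing F k) = - fst (crossing F k)"
    and "int k \<le> side k (start F k) * fst (crossing F k)"
proof -
  note adm = familiesD(5)[OF F k]
  show snd: "snd (crossing F k) = - fst (crossing F k)"
    using admissible_pathsD(2)[OF adm] by (simp add: crossing_def height_def)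
  have "crossing F k \<in> set (fst (paths F k))"
    unfolding crossing_def by (rule lattice_path_ends(4)[OF admissible_pathsD(1)[OF adm]])
  then have "2 * int k \<le> side k (start F k) * (fst (crossing F k) - snd (crossing F k))"
    using k by (intro initial_path_side[OF _ familiesD(3)[OF F k] adm]) auto
  then show "int k \<le> side k (start F k) * fst (crossing F k)"
    unfolding snd by simp
qed

lemma height_start: "s \<in> {alpha i, beta i} \<Longrightarrow> height s = 2 - 4 * int i"
  by (auto simp: height_def alpha_def beta_def)

lemma clock_start: "s \<in> {alpha i, beta i} \<Longrightarrow> clock (side i s) s = 1 - int i"
  by (auto simp: clock_def side_def alpha_def beta_def)

lemma crossings_ordered:
  assumes F: "F \<in> disjoint_families n E" and k: "i \<in> {1..n}" "i' \<in> {1..n}" "i < i'"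
  defines "\<epsilon> \<equiv> side i' (start F i')"
  shows "\<epsilon> * fst (crossing F i) < \<epsilon> * fst (crossing F i')"
proof -
  have disj: "set (fst (paths F i)) \<inter> set (fst (paths F i')) = {}"
    using k by (intro disjoint_familiesD(2)[OF F]) auto
  note fam = disjoint_familiesD(1)[OF F]
  note x = crossing_coordinates[OF fam k(1)]
    and x' = crossing_coordinates[OF fam k(2), folded \<epsilon>_def]
  have eps: "\<epsilon> \<in> {1, -1}" unfolding \<epsilon>_def by (rule side_cases)
  show ?thesis
  proof (cases "side i (start F i) = \<epsilon>")
    case False
    then have "side i (start F i) = - \<epsilon>"
      using side_cases[of i "start F i"] eps by auto
    with x(2) x'(2) k show ?thesis by simp
  next
    case True
    have ge: "i \<ge> 1" "i' \<ge> 1" using k by auto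
    note s = familiesD(3)[OF fam k(1)] and s' = familiesD(3)[OF fam k(2)]
    have path: "lattice_path {(1, 1), (\<epsilon>, - \<epsilon>)} (start F i) (crossing F i) (fst (paths F i))"
      and path': "lattice_path {(1, 1), (\<epsilon>, - \<epsilon>)} (start F i') (crossing F i') (fst (paths F i'))"
      using admissible_pathsD(1)[OF familiesD(5)[OF fam k(1)]]
        admissible_pathsD(1)[OF familiesD(5)[OF fam k(2)]]
        initial_steps_side[OF ge(1) s] initial_steps_side[OF ge(2) s'] True
      by (simp_all add: crossing_def \<epsilon>_def)
    have crossing: "height (crossing F i) = 0" "height (crossing F i') = 0"
      "clock \<epsilon> (crossing F i) = \<epsilon> * fst (crossing F i)"
      "clock \<epsilon> (crossing F i') = \<epsilon> * fst (crossing F i')"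
      using x(1) x'(1) eps by (auto simp: height_def clock_def)
    have "clock \<epsilon> (crossing F i) < clock \<epsilon> (crossing F i')"
      using k x'(2) crossing height_start[OF s] clock_start[OF s] height_start[OF s']
        clock_start[OF s']
      by (intro initial_paths_ordered[OF eps path path' disj
        admissible_pathsD(3)[OF familiesD(5)[OF fam k(1)]]])
        (simp_all add: True flip: \<epsilon>_def)
    then show ?thesis
      by (simp add: crossing)
  qed
qed

lemma perm_reverses_crossings:
  assumes F: "F \<in> disjoint_families n (endpoints n m h)" and h: "mono h"
    and k: "k \<in> {1..n}" "k' \<in> {1..n}" and less: "fst (crossing F k) < fst (crossing F k')"
  shows "perm F k' < perm F k"
proof (rule ccontr)
  assume "\<not> perm F k' < perm F k"
  have "k \<noteq> k'" using less by auto
  then have disj: "set (snd (paths F k)) \<inter> set (snd (paths F k')) = {}"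
    by (rule disjoint_familiesD(3)[OF F k])
  note fam = disjoint_familiesD(1)[OF F]
  have "perm F k \<noteq> perm F k'"
    using permutes_inj[OF familiesD(1)[OF fam]] \<open>k \<noteq> k'\<close> by (auto dest: injD)
  with \<open>\<not> perm F k' < perm F k\<close> have perm: "perm F k < perm F k'" by simp
  note e = endpointsD[OF familiesD(4)[OF fam k(1)]]
    and e' = endpointsD[OF familiesD(4)[OF fam k(2)]]
  have "fst (endpoint F k) < fst (endpoint F k')"
  proof (rule final_paths_ordered[OF _ _ disj])
    show "lattice_path {(1, 0), (0, 1)} (crossing F k) (endpoint F k) (snd (paths F k))"
      "lattice_path {(1, 0), (0, 1)} (crossing F k') (endpoint F k') (snd (paths F k'))"
      unfolding crossing_def using familiesD(5)[OF fam] k by (auto intro: admissible_pathsD(4))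
    show "height (crossing F k) = height (crossing F k')"
      using crossing_coordinates(1)[OF fam] k by (simp add: height_def)
    show "height (endpoint F k) \<le> height (endpoint F k')"
      using h perm by (simp add: e e' monoD)
  qed (rule less)
  moreover have "fst (endpoint F k) \<ge> int n - int (perm F k) + int (m div 2)"
    "fst (endpoint F k') \<le> int n - int (perm F k') + int (m div 2) + 1"
    using e(2) e'(2) by (auto simp: abscissae_def Let_def split: if_splits)
  ultimately show False using perm by simp
qed

lemma inversions_perm_disjoint_family:
  assumes F: "F \<in> disjoint_families n (endpoints n m h)" and h: "mono h"
  shows "inversions {1..n} (perm F) =
    {(i, j). i \<in> {1..n} \<and> j \<in> {1..n} \<and> i < j \<and> start F j = beta j}"
proof -
  have "perm F j < perm F i \<longleftrightarrow> start F j = beta j" if ij: "i \<in> {1..n}" "j \<in> {1..n}" "i < j" for i j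
  proof (cases "start F j = beta j")
    case True
    then have "fst (crossing F i) < fst (crossing F j)"
      using crossings_ordered[OF F ij] by (simp add: side_def)
    with True show ?thesis using perm_reverses_crossings[OF F h ij(1,2)] by simp
  next
    case False
    then have "fst (crossing F j) < fst (crossing F i)"
      using crossings_ordered[OF F ij] by (simp add: side_def)
    with False show ?thesis using perm_reverses_crossings[OF F h ij(2,1)] by simp
  qed
  then show ?thesis by (auto simp: inversions_def)
qed

lemma family_sign_disjoint_family:
  assumes F: "F \<in> disjoint_families n (endpoints n m h)" and h: "mono h"
  shows "family_sign n F = (-1) ^ (\<Sum>i | i \<in> {1..n} \<and> start F i = beta i. i)"
proof -
  define B where "B = {i \<in> {1..n}. start F i = beta i}"
  have "inversions {1..n} (perm F) = prod.swap ` (SIGMA j:B. {1..<j})"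
    unfolding inversions_perm_disjoint_family[OF F h] by (force simp: B_def)
  then have "card (inversions {1..n} (perm F)) = (\<Sum>j\<in>B. j - 1)"
    by (simp add: card_image B_def)
  moreover have "(\<Sum>j\<in>B. j - 1) + card B = (\<Sum>j\<in>B. j)"
    unfolding card_eq_sum sum.distrib[symmetric] by (intro sum.cong) (auto simp: B_def)
  ultimately show ?thesis
    unfolding family_sign_def B_def[symmetric]
      sign_eq_inversions[OF familiesD(1)[OF disjoint_familiesD(1)[OF F]]]
    by (simp flip: power_add)
qed

lemma alpha_sign_disjoint_family:
  assumes F: "F \<in> disjoint_families n (endpoints n m h)" and h: "mono h"
  shows "alpha_sign n F = (-1) ^ ((n + 1) choose 2) * family_sign n F"
proof -
  define A B where "A = {i \<in> {1..n}. start F i = alpha i}" "B = {i \<in> {1..n}. start F i = beta i}"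
  have "A \<union> B = {1..n}"
    using familiesD(3)[OF disjoint_familiesD(1)[OF F]] by (fastforce simp: A_B_def)
  moreover have "A \<inter> B = {}"
    using alpha_neq_beta by (fastforce simp: A_B_def)
  moreover have "finite A" "finite B"
    by (simp_all add: A_B_def)
  ultimately have "(\<Sum>i=1..n. i) = (\<Sum>i\<in>A. i) + (\<Sum>i\<in>B. i)"
    using sum.union_disjoint[of A B "\<lambda>i. i"] by simp
  moreover have "(\<Sum>i=1..n. i) = (n + 1) choose 2"
    by (induction n) (auto simp: numeral_2_eq_2)
  ultimately have choose: "(n + 1) choose 2 = (\<Sum>i\<in>A. i) + (\<Sum>i\<in>B. i)"
    by metis
  show ?thesis
    unfolding family_sign_disjoint_family[OF F h] alpha_sign_def A_B_def[symmetric] choose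
    by (simp add: power_add mult.assoc flip: power_mult_distrib)
qed

subsection \<open>The theorem\<close>

lemma R_eq_sum_disjoint_families:
  fixes X :: "nat \<Rightarrow> 'a::field"
  assumes gen: "generic n X" and h: "w = 1 \<and> h = (\<lambda>_. int n - 1) \<or> w = 0 \<and> h = (\<lambda>j. int j - 1)"
  shows "R X w n m = (-1) ^ ((n + 1) choose 2) * prefactor X w n m *
      (\<Sum>F\<in>disjoint_families n (endpoints n m h). signed_weight X w n F)" (is ?signed)
    and "R X w n m = prefactor X w n m *
      (\<Sum>F\<in>disjoint_families n (endpoints n m h). of_int (alpha_sign n F) * family_weight X w n F)"
proof -
  let ?E = "endpoints n m h"
  have h': "h = (\<lambda>_. int n - 1) \<or> w = 0 \<and> h = (\<lambda>j. int j - 1)" using h by auto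
  have "segment_weight X w (perm F k) (snd (paths F k)) = 1"
    if "F \<in> families n ?E" "k \<in> {1..n}" for F k
    using endpointsD(1)[OF familiesD(4)[OF that]] h
    by (intro segment_weight_final_eq_1[OF admissible_pathsD(4)[OF familiesD(5)[OF that]]]) auto
  then have "(\<Sum>F\<in>disjoint_families n ?E. signed_weight X w n F) =
      (\<Sum>F\<in>initially_disjoint_families n ?E. signed_weight X w n F)"
    by (rule sum_disjoint_families[OF finite_families_endpoints[OF gen h']])
  then show signed: ?signed
    by (simp only: R_eq_sum_initially_disjoint_families[OF gen h'])
  have "mono h" using h by (auto simp: mono_def)
  then have "(\<Sum>F\<in>disjoint_families n ?E. of_int (alpha_sign n F) * family_weight X w n F) =
      (-1) ^ ((n + 1) choose 2) * (\<Sum>F\<in>disjoint_families n ?E. signed_weight X w n F)"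
    unfolding sum_distrib_left
    by (intro sum.cong refl) (simp add: alpha_sign_disjoint_family mult.assoc)
  then show "R X w n m = prefactor X w n m *
      (\<Sum>F\<in>disjoint_families n ?E. of_int (alpha_sign n F) * family_weight X w n F)"
    unfolding signed by (simp only: mult_ac)
qed

lemma endpoints_odd:
  "E_odd n l = endpoints n (2 * l + 1) (\<lambda>_. int n - 1)"
  "E'_odd n l = endpoints n (2 * l + 1) (\<lambda>j. int j - 1)"
  by (auto simp: fun_eq_iff E_odd_def E'_odd_def endpoints_def abscissae_def)

lemma endpoints_even:
  "E_even n l = endpoints n (2 * l) (\<lambda>_. int n - 1)"
  "E'_even n l = endpoints n (2 * l) (\<lambda>j. int j - 1)"
  by (auto simp: fun_eq_iff E_even_def E'_even_def endpoints_def abscissae_def)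

theorem theorem4p1:
  fixes n l :: nat and w :: "'a::field" and X :: "nat \<Rightarrow> 'a"
  assumes "n \<ge> 1" and "generic n X"
  defines "C_odd \<equiv> (\<Prod>i=1..n. X i ^ l * (inverse (X i) + 1 + w + X i) * (1 + X i))"
    and "C_even \<equiv> (\<Prod>i=1..n. X i ^ l * (inverse (X i) + 1 + w + X i))"
  shows
    "(R X w n (2 * l + 1) = (-1) ^ ((n + 1) choose 2) * C_odd *
        (\<Sum>F\<in>initially_disjoint_families n (E_odd n l).
           of_int (family_sign n F) * family_weight X w n F) \<and>
      R X w n (2 * l + 1) = (-1) ^ ((n + 1) choose 2) * C_odd *
        (\<Sum>F\<in>families n (E_odd n l).
           of_int (family_sign n F) * family_weight X w n F) \<and>
      (w = 1 \<longrightarrow>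
        R X w n (2 * l + 1) = (-1) ^ ((n + 1) choose 2) * C_odd *
          (\<Sum>F\<in>disjoint_families n (E_odd n l).
             of_int (family_sign n F) * family_weight X w n F)) \<and>
      (w = 0 \<longrightarrow>
        R X w n (2 * l + 1) = (-1) ^ ((n + 1) choose 2) * C_odd *
          (\<Sum>F\<in>disjoint_families n (E'_odd n l).
             of_int (family_sign n F) * family_weight X w n F)) \<and>
      (w = 1 \<longrightarrow>
        R X w n (2 * l + 1) = C_odd *
          (\<Sum>F\<in>disjoint_families n (E_odd n l).
             of_int (alpha_sign n F) * family_weight X w n F)) \<and>
      (w = 0 \<longrightarrow>
        R X w n (2 * l + 1) = C_odd *
          (\<Sum>F\<in>disjoint_families n (E'_odd n l).
             of_int (alpha_sign n F) * family_weight X w n F))) \<and>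
     (R X w n (2 * l) = (-1) ^ ((n + 1) choose 2) * C_even *
        (\<Sum>F\<in>initially_disjoint_families n (E_even n l).
           of_int (family_sign n F) * family_weight X w n F) \<and>
      R X w n (2 * l) = (-1) ^ ((n + 1) choose 2) * C_even *
        (\<Sum>F\<in>families n (E_even n l).
           of_int (family_sign n F) * family_weight X w n F) \<and>
      (w = 1 \<longrightarrow>
        R X w n (2 * l) = (-1) ^ ((n + 1) choose 2) * C_even *
          (\<Sum>F\<in>disjoint_families n (E_even n l).
             of_int (family_sign n F) * family_weight X w n F)) \<and>
      (w = 0 \<longrightarrow>
        R X w n (2 * l) = (-1) ^ ((n + 1) choose 2) * C_even *
          (\<Sum>F\<in>disjoint_families n (E'_even n l).
             of_int (family_sign n F) * family_weight X w n F)) \<and>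
      (w = 1 \<longrightarrow>
        R X w n (2 * l) = C_even *
          (\<Sum>F\<in>disjoint_families n (E_even n l).
             of_int (alpha_sign n F) * family_weight X w n F)) \<and>
      (w = 0 \<longrightarrow>
        R X w n (2 * l) = C_even *
          (\<Sum>F\<in>disjoint_families n (E'_even n l).
             of_int (alpha_sign n F) * family_weight X w n F)))"
proof -
  have C: "C_odd = prefactor X w n (2 * l + 1)" "C_even = prefactor X w n (2 * l)"
    by (simp_all add: C_odd_def C_even_def prefactor_def parity_factor_def)
  note all = R_eq_sum_families[where w = w, OF assms(2) disjI1[OF refl]]
    and initially_disjoint =
      R_eq_sum_initially_disjoint_families[where w = w, OF assms(2) disjI1[OF refl]]
    and disjoint = R_eq_sum_disjoint_families[OF assms(2)]
  show ?thesis
    unfolding endpoints_odd endpoints_even C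
    by (intro conjI impI all initially_disjoint disjoint) simp_all
qed

end
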